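(* Let $n\ge 1$ and let $f_1,f_2,\dots,f_n$ be a regular sequence of homogeneous symmetric polynomials in $R_n=\mathbb{C}[x_1,\dots,x_n]$. Then $n!$ divides $(\deg f_1)(\deg f_2)\cdots(\deg f_n)$.
   Context: A polynomial in $R_n$ is symmetric if it is invariant under all permutations of the variables $x_1,\dots,x_n$. A set of $n$ homogeneous polynomials (of positive degree) in $R_n$ is a regular sequence if and only if their only common zero in $\mathbb{C}^n$ is $(0,\dots,0)$. *)

theory Defs
  imports Complex_Main "HOL-Library.Poly_Mapping" "HOL-Combinatorics.Permutations"
begin

text \<open>
  A monomial \<open>x\<^sub>1^{m\<^sub>1} x\<^sub>2^{m\<^sub>2} \<dots>\<close> is its finitely supported exponent function, and a polynomial over
  the complex numbers is a finitely supported function from monomials to coefficients; with this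
  representation, \<open>+\<close> and \<open>*\<close> of the library are addition and multiplication of polynomials.
\<close>

type_synonym monomial = "nat \<Rightarrow>\<^sub>0 nat"
type_synonym cpoly = "monomial \<Rightarrow>\<^sub>0 complex"

definition poly_ring :: "nat \<Rightarrow> cpoly set" where
  "poly_ring n = {p. \<forall>m\<in>Poly_Mapping.keys p. Poly_Mapping.keys m \<subseteq> {1..n}}"

definition mono_degree :: "monomial \<Rightarrow> nat" where
  "mono_degree m = (\<Sum>i\<in>Poly_Mapping.keys m. Poly_Mapping.lookup m i)"

text \<open>Convention: the zero polynomial has degree \<open>0\<close>.\<close>

definition total_degree :: "cpoly \<Rightarrow> nat" where
  "total_degree p = Max (insert 0 (mono_degree ` Poly_Mapping.keys p))"

definition homogeneous :: "cpoly \<Rightarrow> bool" where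
  "homogeneous p \<longleftrightarrow> (\<exists>d. \<forall>m\<in>Poly_Mapping.keys p. mono_degree m = d)"

definition poly_eval :: "(nat \<Rightarrow> complex) \<Rightarrow> cpoly \<Rightarrow> complex" where
  "poly_eval a p = (\<Sum>m\<in>Poly_Mapping.keys p.
     Poly_Mapping.lookup p m * (\<Prod>i\<in>Poly_Mapping.keys m. a i ^ Poly_Mapping.lookup m i))"

text \<open>
  For a permutation \<open>\<sigma>\<close>, this is the substitution \<open>x\<^sub>i \<mapsto> x\<^sub>\<sigma>\<^sub>(\<^sub>i\<^sub>)\<close>: the coefficient of the result at the
  exponent function \<open>m\<close> is the coefficient of \<open>p\<close> at \<open>m \<circ> \<sigma>\<close>.
\<close>

definition permute_vars :: "(nat \<Rightarrow> nat) \<Rightarrow> cpoly \<Rightarrow> cpoly" where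
  "permute_vars \<sigma> p = Poly_Mapping.map_key (Poly_Mapping.map_key \<sigma>) p"

definition symmetric_poly :: "nat \<Rightarrow> cpoly \<Rightarrow> bool" where
  "symmetric_poly n p \<longleftrightarrow> (\<forall>\<sigma>. \<sigma> permutes {1..n} \<longrightarrow> permute_vars \<sigma> p = p)"

text \<open>
  Regular sequences of \<open>n\<close> homogeneous polynomials \<open>f 1, \<dots>, f n\<close> of positive degree in \<open>n\<close> variables.
  A point of \<open>\<complex>\<^sup>n\<close> is given by the values of \<open>a\<close> on \<open>{1..n}\<close>; other values of \<open>a\<close> do not affect
  the evaluation of elements of \<open>poly_ring n\<close>.
\<close>

definition regular_sequence :: "nat \<Rightarrow> (nat \<Rightarrow> cpoly) \<Rightarrow> bool" where
  "regular_sequence n f \<longleftrightarrow>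
     (\<forall>i\<in>{1..n}. f i \<in> poly_ring n \<and> homogeneous (f i) \<and> total_degree (f i) > 0) \<and>
     (\<forall>a. (\<forall>i\<in>{1..n}. poly_eval a (f i) = 0) \<longleftrightarrow> (\<forall>j\<in>{1..n}. a j = 0))"

end

theory Submission
  imports Defs "HOL-Library.Function_Algebras" "HOL-Library.FuncSet"
    "HOL-Analysis.Continuum_Not_Denumerable"
    "HOL-Computational_Algebra.Fundamental_Theorem_Algebra" "HOL-Computational_Algebra.Primes"
begin

text \<open>
  Comparing multiplicities of primes, it suffices that for every \<open>k\<close> at least \<open>m = \<lfloor>n / k\<rfloor>\<close> of the
  degrees are divisible by \<open>k\<close>. Let \<open>\<omega>\<close> be a primitive \<open>k\<close>-th root of unity and consider the points of
  \<open>\<complex>\<^sup>n\<close> whose coordinates are \<open>\<omega>\<^sup>s y\<^sub>q\<close> (\<open>s < k\<close>, \<open>q < m\<close>), padded by zeros. Multiplication by \<open>\<omega>\<close>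
  permutes the coordinates of such a point, so a symmetric form whose degree is not divisible by
  \<open>k\<close> vanishes there. The other forms restrict to forms in \<open>y\<close> whose only common zero is the origin
  of \<open>\<complex>\<^sup>m\<close>, hence there are at least \<open>m\<close> of them.

  For the last step, suppose that \<open>r < m\<close> forms of positive degree have no common zero but the
  origin. By the Nullstellensatz the ideal they generate contains all forms of large degree, so the
  polynomials of degree at most \<open>N\<close> are spanned by boundedly many monomials times the monomials
  of degree at most \<open>N\<close> in the \<open>r\<close> forms. That is a space of dimension \<open>O(N\<^sup>r)\<close>, whereas the polynomials
  separating the points of an \<open>m\<close>-dimensional grid span one of dimension of order \<open>N\<^sup>m\<close>.
\<close>

section \<open>Polynomial functions\<close>

definition cscale :: "complex \<Rightarrow> ('a \<Rightarrow> complex) \<Rightarrow> 'a \<Rightarrow> complex" where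
  "cscale c f = (\<lambda>x. c * f x)"

lemma cscale_apply: "cscale c f x = c * f x"
  by (simp add: cscale_def)

text \<open>As simplification rules these also expand unapplied sums and products of functions.\<close>

declare plus_fun_apply [simp del] times_fun_apply [simp del] zero_fun_apply [simp del] one_fun_apply [simp del]

lemmas fun_apply = plus_fun_apply times_fun_apply zero_fun_apply one_fun_apply cscale_apply

lemma fun_power_apply: "(h ^ k) x = h x ^ k"
  for h :: "'a \<Rightarrow> 'b::comm_monoid_mult"
  by (induction k) (auto simp: fun_apply)

lemma fun_sum_apply: "(\<Sum>i\<in>I. h i) x = (\<Sum>i\<in>I. h i x)"
  for h :: "'i \<Rightarrow> 'a \<Rightarrow> 'b::comm_monoid_add"
  by (induction I rule: infinite_finite_induct) (auto simp: fun_apply)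

lemma fun_prod_apply: "(\<Prod>i\<in>I. h i) x = (\<Prod>i\<in>I. h i x)"
  for h :: "'i \<Rightarrow> 'a \<Rightarrow> 'b::comm_monoid_mult"
  by (induction I rule: infinite_finite_induct) (auto simp: fun_apply)

interpretation fs: vector_space cscale
  by standard (auto simp: fun_eq_iff fun_apply algebra_simps)

text \<open>Multiplication is bilinear, so the products of generators decide; each factor is
  expanded in turn. The product rules for forms, for polynomials of bounded degree and for graded
  parts of ideals all reduce to this.\<close>

lemma span_times:
  assumes f: "f \<in> fs.span S" and g: "g \<in> fs.span T"
    and st: "\<And>s t. s \<in> S \<Longrightarrow> t \<in> T \<Longrightarrow> s * t \<in> fs.span U"
  shows "f * g \<in> fs.span U"
proof -
  have 1: "s * g \<in> fs.span U" if s: "s \<in> S" for s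
    using g
  proof (induction rule: fs.span_induct_alt)
    case base
    then show ?case by (simp add: fs.span_zero)
  next
    case (step c x y)
    have "s * (cscale c x + y) = cscale c (s * x) + s * y"
      by (auto simp: fun_eq_iff fun_apply algebra_simps)
    then show ?case using step st[OF s] by (auto intro: fs.span_add fs.span_scale)
  qed
  show ?thesis using f
  proof (induction rule: fs.span_induct_alt)
    case base
    then show ?case by (simp add: fs.span_zero)
  next
    case (step c x y)
    have "(cscale c x + y) * g = cscale c (x * g) + y * g"
      by (auto simp: fun_eq_iff fun_apply algebra_simps)
    then show ?case using step 1 by (auto intro: fs.span_add fs.span_scale)
  qed
qed

text \<open>Independent vectors in a span are no more numerous than its generators. The relation is
  indexed by \<open>I\<close> and read pointwise, so that it can be evaluated at chosen points and
  covers families with repetitions.\<close>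

lemma exists_linear_relation:
  fixes g :: "'i \<Rightarrow> 'a \<Rightarrow> complex"
  assumes S: "finite S" and I: "finite I" and card: "card S < card I" and g: "g ` I \<subseteq> fs.span S"
  obtains u where "\<exists>i\<in>I. u i \<noteq> 0" "\<And>x. (\<Sum>i\<in>I. u i * g i x) = 0"
proof (cases "inj_on g I")
  case True
  have "fs.dependent (g ` I)"
    using fs.independent_span_bound[OF S _ g] card card_image[OF True] by force
  then obtain w where w: "\<exists>v\<in>g ` I. w v \<noteq> 0" "(\<Sum>v\<in>g ` I. cscale (w v) v) = 0"
    using fs.dependent_finite[of "g ` I"] I by auto
  have "(\<Sum>i\<in>I. w (g i) * g i x) = 0" for x
  proof -
    have "(\<Sum>i\<in>I. cscale (w (g i)) (g i)) = 0"
      using w(2) sum.reindex[OF True, of "\<lambda>v. cscale (w v) v"] by simp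
    then have "(\<Sum>i\<in>I. cscale (w (g i)) (g i)) x = 0" by (simp add: fun_apply)
    then show ?thesis by (simp only: fun_sum_apply cscale_apply)
  qed
  then show thesis using w(1) that[of "\<lambda>i. w (g i)"] by auto
next
  case False
  then obtain i j where ij: "i \<in> I" "j \<in> I" "i \<noteq> j" "g i = g j" by (auto simp: inj_on_def)
  \<comment> \<open>A repeated member supplies the relation by itself:
    \<open>g i - g j = 0\<close>.\<close>
  define u where "u = (\<lambda>k. if k = i then 1 else if k = j then -1 else (0::complex))"
  have "(\<Sum>k\<in>I. u k * g k x) = 0" for x
  proof -
    have "(\<Sum>k\<in>I. u k * g k x) = (\<Sum>k\<in>{i,j}. u k * g k x)"
      using ij I by (intro sum.mono_neutral_right) (auto simp: u_def)
    also have "\<dots> = 0" using ij by (simp add: u_def)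
    finally show ?thesis .
  qed
  moreover have "u i \<noteq> 0" by (simp add: u_def)
  ultimately show thesis using that ij(1) by blast
qed

section \<open>Monomials, forms and polynomials as functions\<close>

definition monomial_fun :: "nat set \<Rightarrow> (nat \<Rightarrow> nat) \<Rightarrow> (nat \<Rightarrow> complex) \<Rightarrow> complex" where
  "monomial_fun V \<alpha> = (\<lambda>x. \<Prod>i\<in>V. x i ^ \<alpha> i)"

text \<open>Polynomials are represented by functions of a point, so sums, products and substitutions
  are pointwise. Being a span, each \<open>forms V d\<close> contains 0, which thus counts as a form
  of every degree.\<close>

definition forms :: "nat set \<Rightarrow> nat \<Rightarrow> ((nat \<Rightarrow> complex) \<Rightarrow> complex) set" where
  "forms V d = fs.span {monomial_fun V \<alpha> | \<alpha>. sum \<alpha> V = d}"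

definition polys_upto :: "nat set \<Rightarrow> nat \<Rightarrow> ((nat \<Rightarrow> complex) \<Rightarrow> complex) set" where
  "polys_upto V d = fs.span {monomial_fun V \<alpha> | \<alpha>. sum \<alpha> V \<le> d}"

definition polys :: "nat set \<Rightarrow> ((nat \<Rightarrow> complex) \<Rightarrow> complex) set" where
  "polys V = (\<Union>d. polys_upto V d)"

lemma monomial_fun_mult: "monomial_fun V \<alpha> * monomial_fun V \<beta> = monomial_fun V (\<lambda>i. \<alpha> i + \<beta> i)"
  by (auto simp: monomial_fun_def fun_eq_iff fun_apply power_add prod.distrib)

lemma monomial_fun_in_forms: "monomial_fun V \<alpha> \<in> forms V (sum \<alpha> V)"
  unfolding forms_def by (rule fs.span_base) auto

lemma forms_mult:
  assumes "f \<in> forms V a" "g \<in> forms V b" shows "f * g \<in> forms V (a + b)"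
  using assms unfolding forms_def
  by (rule span_times) (auto simp: monomial_fun_mult sum.distrib intro!: fs.span_base)

lemma polys_upto_mult:
  assumes "f \<in> polys_upto V a" "g \<in> polys_upto V b" shows "f * g \<in> polys_upto V (a + b)"
  using assms unfolding polys_upto_def
proof (rule span_times)
  fix s t
  assume "s \<in> {monomial_fun V \<alpha> |\<alpha>. sum \<alpha> V \<le> a}" "t \<in> {monomial_fun V \<alpha> |\<alpha>. sum \<alpha> V \<le> b}"
  then obtain \<alpha> \<beta> where *: "s = monomial_fun V \<alpha>" "t = monomial_fun V \<beta>" "sum \<alpha> V \<le> a" "sum \<beta> V \<le> b"
    by auto
  show "s * t \<in> fs.span {monomial_fun V \<alpha> |\<alpha>. sum \<alpha> V \<le> a + b}"
    using * by (intro fs.span_base CollectI exI[of _ "\<lambda>i. \<alpha> i + \<beta> i"])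
      (auto simp: monomial_fun_mult sum.distrib)
qed

lemma polys_upto_mono: "a \<le> b \<Longrightarrow> polys_upto V a \<subseteq> polys_upto V b"
  unfolding polys_upto_def by (intro fs.span_mono) auto

lemma forms_subset_polys: "forms V d \<subseteq> polys V"
proof -
  have "forms V d \<subseteq> polys_upto V d"
    unfolding forms_def polys_upto_def by (intro fs.span_mono) auto
  then show ?thesis unfolding polys_def by blast
qed

lemma polys_mult: "f \<in> polys V \<Longrightarrow> g \<in> polys V \<Longrightarrow> f * g \<in> polys V"
  unfolding polys_def using polys_upto_mult by blast

lemma polys_add: assumes "f \<in> polys V" "g \<in> polys V" shows "f + g \<in> polys V"
proof -
  obtain a b where "f \<in> polys_upto V a" "g \<in> polys_upto V b"
    using assms unfolding polys_def by blast
  then have "f \<in> polys_upto V (max a b)" "g \<in> polys_upto V (max a b)"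
    using polys_upto_mono[of _ "max a b"] by (meson max.cobounded1 max.cobounded2 subsetD)+
  then have "f + g \<in> polys_upto V (max a b)"
    unfolding polys_upto_def by (rule fs.span_add)
  then show ?thesis unfolding polys_def by blast
qed

lemma const_in_polys_upto: "(\<lambda>_. c) \<in> polys_upto V d"
proof -
  have "monomial_fun V (\<lambda>_. 0) \<in> polys_upto V d"
    unfolding polys_upto_def by (rule fs.span_base) (auto intro!: exI[of _ "\<lambda>_. 0"])
  then have "cscale c (monomial_fun V (\<lambda>_. 0)) \<in> polys_upto V d"
    unfolding polys_upto_def by (rule fs.span_scale)
  also have "cscale c (monomial_fun V (\<lambda>_. 0)) = (\<lambda>_. c)"
    by (auto simp: fun_eq_iff monomial_fun_def fun_apply)
  finally show ?thesis .
qed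

lemma const_in_polys: "(\<lambda>_. c) \<in> polys V"
  using const_in_polys_upto unfolding polys_def by blast

lemma const_in_forms: "(\<lambda>_. c) \<in> forms V 0"
proof -
  have "monomial_fun V (\<lambda>_. 0) \<in> forms V 0"
    using monomial_fun_in_forms[of V "\<lambda>_. 0"] by simp
  then have "cscale c (monomial_fun V (\<lambda>_. 0)) \<in> forms V 0"
    unfolding forms_def by (rule fs.span_scale)
  also have "cscale c (monomial_fun V (\<lambda>_. 0)) = (\<lambda>_. c)"
    by (auto simp: fun_eq_iff monomial_fun_def fun_apply)
  finally show ?thesis .
qed

lemma var_power_monomial:
  assumes "finite V" "i \<in> V"
  shows "(\<lambda>x. x i ^ N) = monomial_fun V (\<lambda>j. if j = i then N else 0)"
proof
  fix x :: "nat \<Rightarrow> complex"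
  have "monomial_fun V (\<lambda>j. if j = i then N else 0) x = (\<Prod>j\<in>V. if j = i then x j ^ N else 1)"
    unfolding monomial_fun_def by (intro prod.cong) auto
  then show "x i ^ N = monomial_fun V (\<lambda>j. if j = i then N else 0) x"
    using assms by simp
qed

lemma var_power_in_forms:
  assumes "finite V" "i \<in> V" shows "(\<lambda>x. x i ^ N) \<in> forms V N"
  using monomial_fun_in_forms[of V "\<lambda>j. if j = i then N else 0"] assms
  by (simp add: var_power_monomial[OF assms])

lemma var_in_forms: "finite V \<Longrightarrow> i \<in> V \<Longrightarrow> (\<lambda>x. x i) \<in> forms V 1"
  using var_power_in_forms[of V i 1] by simp

lemma var_in_polys: "finite V \<Longrightarrow> i \<in> V \<Longrightarrow> (\<lambda>x. x i) \<in> polys V"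
  using var_in_forms forms_subset_polys by blast

lemma forms_power: "f \<in> forms V a \<Longrightarrow> f ^ k \<in> forms V (k * a)"
proof (induction k)
  case 0
  then show ?case using const_in_forms[of 1 V] by (simp add: one_fun_def)
next
  case (Suc k)
  then show ?case using forms_mult by simp
qed

lemma forms_prod:
  assumes "\<And>i. i \<in> I \<Longrightarrow> h i \<in> forms V (e i)"
  shows "(\<Prod>i\<in>I. h i) \<in> forms V (\<Sum>i\<in>I. e i)"
  using assms
proof (induction I rule: infinite_finite_induct)
  case (insert i I)
  then show ?case using forms_mult by simp
qed (use const_in_forms[of 1 V] in \<open>simp_all add: one_fun_def\<close>)

lemma polys_upto_prod:
  assumes "\<And>i. i \<in> I \<Longrightarrow> h i \<in> polys_upto V (e i)"
  shows "(\<Prod>i\<in>I. h i) \<in> polys_upto V (\<Sum>i\<in>I. e i)"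
  using assms
proof (induction I rule: infinite_finite_induct)
  case (insert i I)
  then show ?case using polys_upto_mult by simp
qed (use const_in_polys_upto[of 1 V] in \<open>simp_all add: one_fun_def\<close>)

text \<open>Constants and variables generate the polynomials as an algebra: powers come first, then
  monomials, then linear combinations. Membership in \<open>polys V\<close> is carried along because
  the hypotheses on sums and products ask for it.\<close>

lemma polys_induct [consumes 2, case_names const var add mult]:
  assumes V: "finite V" and f: "f \<in> polys V"
    and const: "\<And>c. P (\<lambda>_. c)"
    and var: "\<And>i. i \<in> V \<Longrightarrow> P (\<lambda>x. x i)"
    and add: "\<And>f g. f \<in> polys V \<Longrightarrow> g \<in> polys V \<Longrightarrow> P f \<Longrightarrow> P g \<Longrightarrow> P (f + g)"
    and mult: "\<And>f g. f \<in> polys V \<Longrightarrow> g \<in> polys V \<Longrightarrow> P f \<Longrightarrow> P g \<Longrightarrow> P (f * g)"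
  shows "P f"
proof -
  have c: "P (\<lambda>_. c) \<and> (\<lambda>_. c) \<in> polys V" for c using const const_in_polys by auto
  have m: "P (f * g) \<and> f * g \<in> polys V" if "P f \<and> f \<in> polys V" "P g \<and> g \<in> polys V" for f g
    using mult polys_mult that by auto
  have pw: "P ((\<lambda>x. x i) ^ k) \<and> (\<lambda>x. x i) ^ k \<in> polys V" if "i \<in> V" for i k
  proof (induction k)
    case 0
    show ?case using c[of 1] by (simp add: one_fun_def)
  next
    case (Suc k)
    show ?case unfolding power_Suc using Suc var[OF that] var_in_polys[OF V that] by (intro m) auto
  qed
  have pr: "P (\<Prod>i\<in>I. (\<lambda>x. x i) ^ \<alpha> i) \<and> (\<Prod>i\<in>I. (\<lambda>x. x i) ^ \<alpha> i) \<in> polys V"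
    if "I \<subseteq> V" for I \<alpha>
    using finite_subset[OF that V] that
  proof (induction I rule: finite_induct)
    case empty
    show ?case using c[of 1] by (simp add: one_fun_def)
  next
    case (insert i I)
    then show ?case unfolding prod.insert[OF insert(1,2)] by (intro m pw) auto
  qed
  have "monomial_fun V \<alpha> = (\<Prod>i\<in>V. (\<lambda>x. x i) ^ \<alpha> i)" for \<alpha>
    by (rule ext) (simp add: fun_prod_apply fun_power_apply monomial_fun_def)
  then have mon: "P (monomial_fun V \<alpha>) \<and> monomial_fun V \<alpha> \<in> polys V" for \<alpha>
    using pr[of V \<alpha>] by simp
  obtain d where "f \<in> polys_upto V d" using f unfolding polys_def by blast
  then have "P f \<and> f \<in> polys V" unfolding polys_upto_def
  proof (induction rule: fs.span_induct_alt)
    case base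
    show ?case using c[of 0] by (simp add: zero_fun_def)
  next
    case (step a x y)
    have "cscale a x = (\<lambda>_. a) * x" by (auto simp: fun_eq_iff fun_apply)
    then show ?case using step m[OF c[of a], of x] mon add polys_add by auto
  qed
  then show ?thesis ..
qed

section \<open>Homogeneity and homogenization\<close>

lemma forms_homogeneous:
  assumes "f \<in> forms V d" shows "f (\<lambda>i. c * x i) = c ^ d * f x"
  using assms unfolding forms_def
proof (induction rule: fs.span_induct_alt)
  case base
  then show ?case by (simp add: fun_apply)
next
  case (step a g h)
  then obtain \<alpha> where \<alpha>: "g = monomial_fun V \<alpha>" "sum \<alpha> V = d" by auto
  have "g (\<lambda>i. c * x i) = c ^ d * g x"
    using \<alpha> by (simp add: monomial_fun_def power_mult_distrib prod.distrib flip: power_sum)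
  then show ?case using step(2) by (simp add: fun_apply algebra_simps)
qed

text \<open>Large powers of \<open>x j\<close> clear the denominators. Asking for all large
  \<open>N\<close> lets a sum use one exponent for both terms and a product split \<open>N\<close>
  as \<open>M1 + (N - M1)\<close>. The equation is confined to \<open>x j \<noteq> 0\<close> because
  division by zero returns the default 0.\<close>

lemma homogenize:
  assumes V: "finite V" and j: "j \<in> V" and p: "p \<in> polys V"
  shows "\<exists>M. \<forall>N\<ge>M. \<exists>h\<in>forms V N. \<forall>x. x j \<noteq> 0 \<longrightarrow> x j ^ N * p (\<lambda>i. x i / x j) = h x"
  using V p
proof (induction rule: polys_induct)
  case (const c)
  show ?case
  proof (intro exI[of _ 0] allI impI)
    fix N :: nat
    show "\<exists>h\<in>forms V N. \<forall>x. x j \<noteq> 0 \<longrightarrow> x j ^ N * c = h x"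
      using forms_mult[OF var_power_in_forms[OF V j, of N] const_in_forms[of c V]]
      by (intro bexI[of _ "(\<lambda>x. x j ^ N) * (\<lambda>_. c)"]) (auto simp: fun_apply)
  qed
next
  case (var i)
  show ?case
  proof (intro exI[of _ 1] allI impI)
    fix N :: nat assume N: "1 \<le> N"
    then obtain k where k: "N = Suc k" by (cases N) auto
    show "\<exists>h\<in>forms V N. \<forall>x. x j \<noteq> 0 \<longrightarrow> x j ^ N * (x i / x j) = h x"
      using forms_mult[OF var_power_in_forms[OF V j, of k] var_in_forms[OF V var]]
      by (intro bexI[of _ "(\<lambda>x. x j ^ k) * (\<lambda>x. x i)"]) (auto simp: k fun_apply)
  qed
next
  case (add f g)
  then obtain M1 M2 where
    1: "\<And>N. N \<ge> M1 \<Longrightarrow> \<exists>h\<in>forms V N. \<forall>x. x j \<noteq> 0 \<longrightarrow> x j ^ N * f (\<lambda>i. x i / x j) = h x" and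
    2: "\<And>N. N \<ge> M2 \<Longrightarrow> \<exists>h\<in>forms V N. \<forall>x. x j \<noteq> 0 \<longrightarrow> x j ^ N * g (\<lambda>i. x i / x j) = h x"
    by blast
  show ?case
  proof (intro exI[of _ "M1 + M2"] allI impI)
    fix N assume "M1 + M2 \<le> N"
    then obtain h1 h2 where h1: "h1 \<in> forms V N" "\<forall>x. x j \<noteq> 0 \<longrightarrow> x j ^ N * f (\<lambda>i. x i / x j) = h1 x"
      and h2: "h2 \<in> forms V N" "\<forall>x. x j \<noteq> 0 \<longrightarrow> x j ^ N * g (\<lambda>i. x i / x j) = h2 x"
      using 1[of N] 2[of N] by auto
    have "h1 + h2 \<in> forms V N" using h1(1) h2(1) unfolding forms_def by (rule fs.span_add)
    then show "\<exists>h\<in>forms V N. \<forall>x. x j \<noteq> 0 \<longrightarrow> x j ^ N * (f + g) (\<lambda>i. x i / x j) = h x"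
      using h1(2) h2(2) by (intro bexI[of _ "h1 + h2"]) (auto simp: fun_apply algebra_simps)
  qed
next
  case (mult f g)
  then obtain M1 M2 where
    1: "\<And>N. N \<ge> M1 \<Longrightarrow> \<exists>h\<in>forms V N. \<forall>x. x j \<noteq> 0 \<longrightarrow> x j ^ N * f (\<lambda>i. x i / x j) = h x" and
    2: "\<And>N. N \<ge> M2 \<Longrightarrow> \<exists>h\<in>forms V N. \<forall>x. x j \<noteq> 0 \<longrightarrow> x j ^ N * g (\<lambda>i. x i / x j) = h x"
    by blast
  show ?case
  proof (intro exI[of _ "M1 + M2"] allI impI)
    fix N assume N: "M1 + M2 \<le> N"
    then have N': "N = M1 + (N - M1)" "M2 \<le> N - M1" by auto
    obtain h1 h2 where h1: "h1 \<in> forms V M1" "\<forall>x. x j \<noteq> 0 \<longrightarrow> x j ^ M1 * f (\<lambda>i. x i / x j) = h1 x"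
      and h2: "h2 \<in> forms V (N - M1)" "\<forall>x. x j \<noteq> 0 \<longrightarrow> x j ^ (N - M1) * g (\<lambda>i. x i / x j) = h2 x"
      using 1[of M1] 2[of "N - M1"] N' by auto
    have "h1 * h2 \<in> forms V N" using forms_mult[OF h1(1) h2(1)] N' by simp
    moreover have "x j ^ N * (f (\<lambda>i. x i / x j) * g (\<lambda>i. x i / x j)) = h1 x * h2 x" if "x j \<noteq> 0" for x
    proof -
      have "x j ^ N = x j ^ M1 * x j ^ (N - M1)" using N by (simp flip: power_add)
      moreover have "x j ^ M1 * f (\<lambda>i. x i / x j) = h1 x"
        "x j ^ (N - M1) * g (\<lambda>i. x i / x j) = h2 x"
        using h1(2) h2(2) that by blast+
      ultimately show ?thesis by (simp add: ac_simps flip: \<open>_ = h1 x\<close> \<open>_ = h2 x\<close>)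
    qed
    ultimately show "\<exists>h\<in>forms V N. \<forall>x. x j \<noteq> 0 \<longrightarrow> x j ^ N * (f * g) (\<lambda>i. x i / x j) = h x"
      by (intro bexI[of _ "h1 * h2"]) (auto simp: fun_apply)
  qed
qed

lemma finite_monomials:
  assumes V: "finite V"
  shows "finite {monomial_fun V \<alpha> | \<alpha>. sum \<alpha> V \<le> d}"
proof (rule finite_subset)
  show "{monomial_fun V \<alpha> | \<alpha>. sum \<alpha> V \<le> d} \<subseteq> monomial_fun V ` (V \<rightarrow>\<^sub>E {0..d})"
  proof safe
    fix \<alpha> :: "nat \<Rightarrow> nat" assume a: "sum \<alpha> V \<le> d"
    have "monomial_fun V \<alpha> = monomial_fun V (restrict \<alpha> V)"
      by (simp add: monomial_fun_def)
    moreover have "restrict \<alpha> V \<in> V \<rightarrow>\<^sub>E {0..d}"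
      using a member_le_sum[of _ V \<alpha>] V by fastforce
    ultimately show "monomial_fun V \<alpha> \<in> monomial_fun V ` (V \<rightarrow>\<^sub>E {0..d})" by blast
  qed
qed (use V in \<open>auto intro: finite_PiE\<close>)

section \<open>The Nullstellensatz\<close>

definition is_ideal :: "nat set \<Rightarrow> ((nat \<Rightarrow> complex) \<Rightarrow> complex) set \<Rightarrow> bool" where
  "is_ideal V J \<longleftrightarrow> J \<subseteq> polys V \<and> 0 \<in> J \<and> (\<forall>p\<in>J. \<forall>q\<in>J. p + q \<in> J) \<and> (\<forall>p\<in>J. \<forall>q\<in>polys V. q * p \<in> J)"

text \<open>For an ideal \<open>J\<close> this is the ideal generated by \<open>J\<close> and
  \<open>x i - c\<close>.\<close>

definition add_root :: "nat set \<Rightarrow> ((nat \<Rightarrow> complex) \<Rightarrow> complex) set \<Rightarrow> nat \<Rightarrow> complex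
    \<Rightarrow> ((nat \<Rightarrow> complex) \<Rightarrow> complex) set" where
  "add_root V J i c = {p + (\<lambda>x. x i - c) * q | p q. p \<in> J \<and> q \<in> polys V}"

lemma is_ideal_sum:
  assumes J: "is_ideal V J" and "\<And>i. i \<in> I \<Longrightarrow> h i \<in> J"
  shows "(\<Sum>i\<in>I. h i) \<in> J"
  using assms(2) by (induction I rule: infinite_finite_induct) (use J in \<open>auto simp: is_ideal_def\<close>)

lemma linear_in_polys:
  assumes "finite V" "i \<in> V" shows "(\<lambda>x. x i - c) \<in> polys V"
proof -
  have "(\<lambda>x. x i) + (\<lambda>_. - c) \<in> polys V"
    using assms by (intro polys_add const_in_polys var_in_polys)
  also have "(\<lambda>x. x i) + (\<lambda>_. - c) = (\<lambda>x. x i - c)" by (auto simp: fun_eq_iff fun_apply)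
  finally show ?thesis .
qed

lemma univariate_in_polys:
  assumes "finite V" "i \<in> V" shows "(\<lambda>x. poly P (x i)) \<in> polys V"
proof (induction P)
  case 0
  show ?case using const_in_polys[of 0] by simp
next
  case (pCons a P)
  have "(\<lambda>_. a) + (\<lambda>x. x i) * (\<lambda>x. poly P (x i)) \<in> polys V"
    using assms pCons by (intro polys_add polys_mult const_in_polys var_in_polys)
  also have "(\<lambda>_. a) + (\<lambda>x. x i) * (\<lambda>x. poly P (x i)) = (\<lambda>x. poly (pCons a P) (x i))"
    by (auto simp: fun_eq_iff fun_apply)
  finally show ?case .
qed

lemma is_ideal_add_root:
  assumes V: "finite V" "i \<in> V" and J: "is_ideal V J"
  shows "is_ideal V (add_root V J i c)" "J \<subseteq> add_root V J i c" "(\<lambda>x. x i - c) \<in> add_root V J i c"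
proof -
  have J': "J \<subseteq> polys V" "0 \<in> J" "\<And>p q. p \<in> J \<Longrightarrow> q \<in> J \<Longrightarrow> p + q \<in> J"
    "\<And>p q. p \<in> J \<Longrightarrow> q \<in> polys V \<Longrightarrow> q * p \<in> J"
    using J unfolding is_ideal_def by auto
  have 0: "0 \<in> polys V" "1 \<in> polys V" 
    using const_in_polys[of 0 V] const_in_polys[of 1 V] by (auto simp: zero_fun_def one_fun_def)
  show sub: "J \<subseteq> add_root V J i c"
  proof
    fix p assume "p \<in> J"
    then show "p \<in> add_root V J i c" unfolding add_root_def using 0
      by (intro CollectI exI[of _ p] exI[of _ 0]) auto
  qed
  show "(\<lambda>x. x i - c) \<in> add_root V J i c" unfolding add_root_def using 0 J'
    by (intro CollectI exI[of _ 0] exI[of _ 1]) auto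
  show "is_ideal V (add_root V J i c)"
    unfolding is_ideal_def
  proof (intro conjI ballI)
    show "add_root V J i c \<subseteq> polys V"
      unfolding add_root_def using J'(1) by (auto intro!: polys_add polys_mult linear_in_polys[OF V])
    show "0 \<in> add_root V J i c" using sub J' by auto
  next
    fix p q assume "p \<in> add_root V J i c" "q \<in> add_root V J i c"
    then obtain a b a' b' where *: "p = a + (\<lambda>x. x i - c) * b" "q = a' + (\<lambda>x. x i - c) * b'"
      "a \<in> J" "a' \<in> J" "b \<in> polys V" "b' \<in> polys V" unfolding add_root_def by blast
    have "p + q = (a + a') + (\<lambda>x. x i - c) * (b + b')" unfolding * by (simp add: algebra_simps)
    moreover have "a + a' \<in> J" "b + b' \<in> polys V" using *(3-6) J'(3) polys_add by auto
    ultimately show "p + q \<in> add_root V J i c" unfolding add_root_def by blast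
  next
    fix p q assume "p \<in> add_root V J i c" and q: "q \<in> polys V"
    then obtain a b where *: "p = a + (\<lambda>x. x i - c) * b"
      "a \<in> J" "b \<in> polys V" unfolding add_root_def by blast
    have "q * p = q * a + (\<lambda>x. x i - c) * (q * b)" unfolding * by (simp add: algebra_simps)
    moreover have "q * a \<in> J" "q * b \<in> polys V" using *(2-3) J'(4) q polys_mult by auto
    ultimately show "q * p \<in> add_root V J i c" unfolding add_root_def by blast
  qed
qed

text \<open>Modulo \<open>J\<close> each \<open>x i - z\<close> is a unit, so it can be cancelled
  from a product lying in \<open>J\<close>. Over the complex numbers \<open>P\<close> splits into
  linear factors; cancelling them one at a time leaves a nonzero constant in
  \<open>J\<close>.\<close>

lemma one_in_ideal_if_univariate:
  assumes V: "finite V" "i \<in> V" and J: "is_ideal V J"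
    and unit: "\<And>c. 1 \<in> add_root V J i c"
    and "P \<noteq> 0" "(\<lambda>x. poly P (x i)) \<in> J"
  shows "1 \<in> J"
  using assms(5-)
proof (induction "degree P" arbitrary: P rule: less_induct)
  case less
  have J': "\<And>p q. p \<in> J \<Longrightarrow> q \<in> J \<Longrightarrow> p + q \<in> J" "\<And>p q. p \<in> J \<Longrightarrow> q \<in> polys V \<Longrightarrow> q * p \<in> J"
    using J unfolding is_ideal_def by auto
  show ?case
  proof (cases "degree P = 0")
    case True
    then obtain a where a: "P = [:a:]" by (auto elim: degree_eq_zeroE)
    have "(\<lambda>_. inverse a) * (\<lambda>x. poly P (x i)) \<in> J"
      using less.prems by (intro J' const_in_polys)
    also have "(\<lambda>_. inverse a) * (\<lambda>x. poly P (x i)) = 1"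
      using less.prems a by (auto simp: fun_eq_iff fun_apply)
    finally show ?thesis .
  next
    case False
    then obtain z where "poly P z = 0"
      using fundamental_theorem_of_algebra[of P] by (auto simp: constant_degree)
    then obtain Q where Q: "P = [:-z, 1:] * Q" by (auto simp: poly_eq_0_iff_dvd)
    obtain p g where pg: "1 = p + (\<lambda>x. x i - z) * g" "p \<in> J" "g \<in> polys V"
      using unit[of z] unfolding add_root_def by auto
    let ?Q = "\<lambda>x. poly Q (x i)"
    \<comment> \<open>Multiplying \<open>1 = p + (x i - z) * g\<close> by \<open>Q\<close> writes
      \<open>Q\<close> as \<open>Q * p + g * P\<close>, where both terms lie in
      \<open>J\<close>.\<close>
    have "?Q * p + g * (\<lambda>x. poly P (x i)) \<in> J"
      using pg less.prems univariate_in_polys[OF V] by (intro J') auto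
    also have "?Q * p + g * (\<lambda>x. poly P (x i)) = ?Q * (p + (\<lambda>x. x i - z) * g)"
      by (auto simp: fun_eq_iff fun_apply Q algebra_simps)
    finally have "?Q \<in> J" by (simp flip: pg(1))
    moreover have "Q \<noteq> 0" using less.prems Q by auto
    moreover from this have "degree Q < degree P" by (simp add: Q degree_mult_eq del: mult_pCons_left)
    ultimately show ?thesis using less.hyps by blast
  qed
qed

text \<open>
  If every \<open>x\<^sub>i - c\<close> is a unit modulo \<open>J\<close>, then uncountably many inverses have degree at most some
  fixed \<open>d\<close>; a linear relation among them, multiplied by the product of the \<open>x\<^sub>i - c\<close> involved,
  yields a nonzero univariate polynomial in \<open>x\<^sub>i\<close> that lies in \<open>J\<close>.
\<close>

lemma exists_proper_add_root:
  assumes V: "finite V" "i \<in> V" and J: "is_ideal V J" and proper: "1 \<notin> J"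
  shows "\<exists>c. 1 \<notin> add_root V J i c"
proof (rule ccontr)
  assume "\<not> ?thesis"
  then have unit: "\<And>c. 1 \<in> add_root V J i c" by blast
  have J': "\<And>p q. p \<in> J \<Longrightarrow> q \<in> J \<Longrightarrow> p + q \<in> J" "\<And>p q. p \<in> J \<Longrightarrow> q \<in> polys V \<Longrightarrow> q * p \<in> J"
    using J unfolding is_ideal_def by auto
  have "\<forall>c. \<exists>p g. 1 = p + (\<lambda>x. x i - c) * g \<and> p \<in> J \<and> g \<in> polys V"
    using unit unfolding add_root_def by blast
  then have "\<exists>p g. \<forall>c. 1 = p c + (\<lambda>x. x i - c) * g c \<and> p c \<in> J \<and> g c \<in> polys V"
    by (simp only: choice_iff)
  then obtain p g where pg: "\<And>c. 1 = p c + (\<lambda>x. x i - c) * g c" "\<And>c. p c \<in> J" "\<And>c. g c \<in> polys V"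
    by auto
  have "(\<Union>d. {c. g c \<in> polys_upto V d}) = UNIV" using pg(3) unfolding polys_def by blast
  then have "\<exists>d. uncountable {c. g c \<in> polys_upto V d}"
    using uncountable_UNIV_complex countable_UN[of UNIV "\<lambda>d. {c. g c \<in> polys_upto V d}"] by auto
  then obtain d where d: "uncountable {c. g c \<in> polys_upto V d}" ..
  then have "infinite {c. g c \<in> polys_upto V d}" by (rule uncountable_infinite)
  \<comment> \<open>One more inverse than there are monomials of degree at most \<open>d\<close>
    forces a linear relation.\<close>
  from infinite_arbitrarily_large[OF this, of "Suc (card {monomial_fun V \<alpha> | \<alpha>. sum \<alpha> V \<le> d})"]
  obtain C where C: "finite C" "C \<subseteq> {c. g c \<in> polys_upto V d}"
    "card C = Suc (card {monomial_fun V \<alpha> | \<alpha>. sum \<alpha> V \<le> d})"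
    by auto
  obtain u where u: "\<exists>c\<in>C. u c \<noteq> 0" "\<And>x. (\<Sum>c\<in>C. u c * g c x) = 0"
    using exists_linear_relation[OF finite_monomials[OF V(1)] C(1), of d g] C(2,3)
    unfolding polys_upto_def by auto
  \<comment> \<open>\<open>P\<close> is the numerator of
    \<open>\<Sum>c\<in>C. u c / (x i - c)\<close> over the common denominator.\<close>
  define R where "R = (\<lambda>c. \<Prod>c'\<in>C - {c}. [:-c', 1:])"
  define P where "P = (\<Sum>c\<in>C. smult (u c) (R c))"
  have Rev: "poly (R c) t = (\<Prod>c'\<in>C - {c}. t - c')" for c t
    by (simp add: R_def poly_prod)
  obtain c0 where c0: "c0 \<in> C" "u c0 \<noteq> 0" using u by blast
  have "poly P c0 = (\<Sum>c\<in>C. u c * (\<Prod>c'\<in>C - {c}. c0 - c'))"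
    by (simp add: P_def poly_sum Rev)
  \<comment> \<open>For \<open>c \<noteq> c0\<close> the product contains the factor
    \<open>c0 - c0\<close>, so only the term of \<open>c0\<close> survives.\<close>
  also have "\<dots> = (\<Sum>c\<in>{c0}. u c * (\<Prod>c'\<in>C - {c}. c0 - c'))"
    using C c0 by (intro sum.mono_neutral_right) auto
  also have "\<dots> \<noteq> 0" using c0 C by simp
  finally have "P \<noteq> 0" by auto
  moreover have "(\<lambda>x. poly P (x i)) \<in> J"
  proof -
    have "(\<Sum>c\<in>C. (\<lambda>x. u c * poly (R c) (x i)) * p c) \<in> J"
    proof (rule is_ideal_sum[OF J])
      fix c assume "c \<in> C"
      have "(\<lambda>x. u c * poly (R c) (x i)) \<in> polys V"
        using univariate_in_polys[OF V, of "smult (u c) (R c)"] by simp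
      then show "(\<lambda>x. u c * poly (R c) (x i)) * p c \<in> J"
        by (rule J'(2)[OF pg(2)])
    qed
    also have "(\<Sum>c\<in>C. (\<lambda>x. u c * poly (R c) (x i)) * p c) = (\<lambda>x. poly P (x i))"
    proof
      fix x
      \<comment> \<open>After this substitution the sum of the \<open>u c * R c * p c\<close> is
        \<open>P\<close> minus the full product times \<open>\<Sum>c\<in>C. u c * g c\<close>, and
        the last sum vanishes.\<close>
      have pe: "p c x = 1 - (x i - c) * g c x" for c
        using fun_cong[OF pg(1)[of c], of x] by (simp add: fun_apply eq_diff_eq)
      have "(\<Sum>c\<in>C. u c * poly (R c) (x i) * p c x)
        = (\<Sum>c\<in>C. u c * poly (R c) (x i) - (\<Prod>c'\<in>C. x i - c') * (u c * g c x))"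
      proof (rule sum.cong)
        fix c assume "c \<in> C"
        then have *: "(\<Prod>c'\<in>C. x i - c') = (x i - c) * poly (R c) (x i)"
          unfolding Rev using C(1) by (rule prod.remove[rotated])
        then show "u c * poly (R c) (x i) * p c x
          = u c * poly (R c) (x i) - (\<Prod>c'\<in>C. x i - c') * (u c * g c x)"
          unfolding pe * by (simp add: algebra_simps)
      qed simp
      also have "\<dots> = poly P (x i) - (\<Prod>c'\<in>C. x i - c') * (\<Sum>c\<in>C. u c * g c x)"
        by (simp add: P_def poly_sum sum_subtractf sum_distrib_left)
      finally show "(\<Sum>c\<in>C. (\<lambda>x. u c * poly (R c) (x i)) * p c) x = poly P (x i)"
        by (simp add: fun_sum_apply u fun_apply)
    qed
    finally show ?thesis .
  qed
  ultimately have "1 \<in> J" using one_in_ideal_if_univariate[OF V J unit] by blast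
  then show False using proper by blast
qed

text \<open>A proper ideal stays proper when a suitable \<open>x i - a i\<close> is adjoined. Doing
  this once for each variable yields a proper ideal \<open>K\<close> modulo which every polynomial
  equals its value at \<open>a\<close>, without choosing a maximal ideal.\<close>

lemma weak_nullstellensatz:
  assumes V: "finite V" and J: "is_ideal V J" and proper: "1 \<notin> J"
  shows "\<exists>a. \<forall>p\<in>J. p a = 0"
proof -
  have "\<exists>K a. is_ideal V K \<and> J \<subseteq> K \<and> 1 \<notin> K \<and> (\<forall>i\<in>I. (\<lambda>x. x i - a i) \<in> K)"
    if "I \<subseteq> V" for I
    using finite_subset[OF that V] that
  proof (induction I rule: finite_induct)
    case empty
    then show ?case using J proper by auto
  next
    case (insert i I)
    then obtain K a where K: "is_ideal V K" "J \<subseteq> K" "1 \<notin> K" "\<forall>i\<in>I. (\<lambda>x. x i - a i) \<in> K" by auto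
    obtain c where c: "1 \<notin> add_root V K i c"
      using exists_proper_add_root[OF V _ K(1,3), of i] insert by auto
    note ar = is_ideal_add_root[OF V _ K(1), of i c]
    show ?case
      using insert.prems insert.hyps K(2,4) ar c
      by (intro exI[of _ "add_root V K i c"] exI[of _ "a(i := c)"]) auto
  qed
  then obtain K a where K: "is_ideal V K" "J \<subseteq> K" "1 \<notin> K" "\<forall>i\<in>V. (\<lambda>x. x i - a i) \<in> K" by blast
  have K': "\<And>p q. p \<in> K \<Longrightarrow> q \<in> K \<Longrightarrow> p + q \<in> K" "\<And>p q. p \<in> K \<Longrightarrow> q \<in> polys V \<Longrightarrow> q * p \<in> K" "0 \<in> K"
    "K \<subseteq> polys V" using K(1) unfolding is_ideal_def by auto
  have sub: "(\<lambda>x. p x - p a) \<in> K" if "p \<in> polys V" for p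
    using V that
  proof (induction rule: polys_induct)
    case (const c)
    then show ?case using K' by (simp add: zero_fun_def)
  next
    case (var i)
    then show ?case using K by auto
  next
    case (add f g)
    have "(\<lambda>x. (f + g) x - (f + g) a) = (\<lambda>x. f x - f a) + (\<lambda>x. g x - g a)"
      by (auto simp: fun_eq_iff fun_apply)
    then show ?case using add K' by simp
  next
    case (mult f g)
    have "(\<lambda>x. (f * g) x - (f * g) a) = g * (\<lambda>x. f x - f a) + (\<lambda>_. f a) * (\<lambda>x. g x - g a)"
      by (auto simp: fun_eq_iff fun_apply algebra_simps)
    then show ?case using mult K' const_in_polys by simp
  qed
  have "p a = 0" if p: "p \<in> J" for p
  proof (rule ccontr)
    assume nz: "p a \<noteq> 0"
    have pK: "p \<in> K" "p \<in> polys V" using p K K' by auto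
    \<comment> \<open>The constant \<open>p a = p - (p - p a)\<close> lies in \<open>K\<close>; if
      it is nonzero, so does 1.\<close>
    have "(\<lambda>_. inverse (p a)) * (p + (\<lambda>_. -1) * (\<lambda>x. p x - p a)) \<in> K"
      using pK sub K' const_in_polys by simp
    also have "(\<lambda>_. inverse (p a)) * (p + (\<lambda>_. -1) * (\<lambda>x. p x - p a)) = 1"
      using nz by (auto simp: fun_eq_iff fun_apply)
    finally show False using K by blast
  qed
  then show ?thesis by blast
qed

section \<open>Common zeros of forms\<close>

text \<open>For forms \<open>F t\<close> of degree \<open>d t\<close> this is the degree
  \<open>N\<close> part of the ideal they generate. The condition \<open>d t \<le> N\<close> guards
  the truncated subtraction.\<close>

definition ideal_component :: "nat set \<Rightarrow> 't set \<Rightarrow> ('t \<Rightarrow> (nat \<Rightarrow> complex) \<Rightarrow> complex) \<Rightarrow> ('t \<Rightarrow> nat) \<Rightarrow> nat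
    \<Rightarrow> ((nat \<Rightarrow> complex) \<Rightarrow> complex) set" where
  "ideal_component V T F d N = fs.span {F t * h | t h. t \<in> T \<and> d t \<le> N \<and> h \<in> forms V (N - d t)}"

lemma ideal_component_mult:
  assumes "p \<in> ideal_component V T F d N" "h \<in> forms V e"
  shows "p * h \<in> ideal_component V T F d (N + e)"
proof -
  have h: "h \<in> fs.span {h}" by (simp add: fs.span_base)
  have *: "F t * g * h \<in> ideal_component V T F d (N + e)"
    if t: "t \<in> T" "d t \<le> N" and g: "g \<in> forms V (N - d t)" for t g
  proof -
    have "g * h \<in> forms V (N + e - d t)" using forms_mult[OF g assms(2)] t by simp
    then show ?thesis unfolding ideal_component_def using t
      by (intro fs.span_base CollectI exI[of _ t] exI[of _ "g * h"]) (auto simp: mult.assoc)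
  qed
  show ?thesis
    unfolding ideal_component_def
  proof (rule span_times[OF assms(1)[unfolded ideal_component_def] h])
    fix s s' assume "s \<in> {F t * h |t h. t \<in> T \<and> d t \<le> N \<and> h \<in> forms V (N - d t)}" "s' \<in> {h}"
    then obtain t g where "s = F t * g" "s' = h" "t \<in> T" "d t \<le> N" "g \<in> forms V (N - d t)" by auto
    then show "s * s' \<in> fs.span {F t * h |t h. t \<in> T \<and> d t \<le> N + e \<and> h \<in> forms V (N + e - d t)}"
      using * unfolding ideal_component_def by simp
  qed
qed

text \<open>
  The homogenization of \<open>p\<close> by \<open>x\<^sub>j\<close> is \<open>x\<^sub>j\<^sup>N p(x / x\<^sub>j)\<close>. The polynomials whose homogenizations of
  large degree lie in the ideal of the forms are themselves an ideal, without zeros as it contains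
  \<open>x\<^sub>j - 1\<close>.
\<close>

lemma var_power_in_ideal:
  fixes T :: "'t set" and F :: "'t \<Rightarrow> (nat \<Rightarrow> complex) \<Rightarrow> complex"
  assumes V: "finite V" "j \<in> V" and F: "\<And>t. t \<in> T \<Longrightarrow> F t \<in> forms V (d t)"
    and nozero: "\<And>a. a j \<noteq> 0 \<Longrightarrow> \<exists>t\<in>T. F t a \<noteq> 0"
  shows "\<exists>N. (\<lambda>x. x j ^ N) \<in> ideal_component V T F d N"
proof -
  define J where "J = {p \<in> polys V. \<exists>M. \<forall>N\<ge>M. \<exists>h\<in>ideal_component V T F d N.
    \<forall>x. x j \<noteq> 0 \<longrightarrow> x j ^ N * p (\<lambda>i. x i / x j) = h x}"
  have zero: "0 \<in> ideal_component V T F d N" for N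
    unfolding ideal_component_def by (rule fs.span_zero)
  have J: "is_ideal V J"
    unfolding is_ideal_def
  proof (intro conjI ballI)
    show "J \<subseteq> polys V" by (auto simp: J_def)
    show "0 \<in> J" unfolding J_def using const_in_polys[of 0 V] zero
      by (auto simp: fun_apply zero_fun_def[symmetric] intro!: exI[of _ 0] bexI[of _ 0])
  next
    fix p q assume p: "p \<in> J" and q: "q \<in> J"
    obtain M1 where 1: "\<And>N. N \<ge> M1 \<Longrightarrow> \<exists>h\<in>ideal_component V T F d N. \<forall>x. x j \<noteq> 0 \<longrightarrow> x j ^ N * p (\<lambda>i. x i / x j) = h x"
      using p unfolding J_def by auto
    obtain M2 where 2: "\<And>N. N \<ge> M2 \<Longrightarrow> \<exists>h\<in>ideal_component V T F d N. \<forall>x. x j \<noteq> 0 \<longrightarrow> x j ^ N * q (\<lambda>i. x i / x j) = h x"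
      using q unfolding J_def by auto
    have "\<exists>h\<in>ideal_component V T F d N. \<forall>x. x j \<noteq> 0 \<longrightarrow> x j ^ N * (p + q) (\<lambda>i. x i / x j) = h x"
      if N: "N \<ge> M1 + M2" for N
    proof -
      obtain h1 where h1: "h1 \<in> ideal_component V T F d N" "\<And>x. x j \<noteq> 0 \<Longrightarrow> x j ^ N * p (\<lambda>i. x i / x j) = h1 x"
        using 1[of N] N by auto
      obtain h2 where h2: "h2 \<in> ideal_component V T F d N" "\<And>x. x j \<noteq> 0 \<Longrightarrow> x j ^ N * q (\<lambda>i. x i / x j) = h2 x"
        using 2[of N] N by auto
      have "h1 + h2 \<in> ideal_component V T F d N" using h1(1) h2(1) unfolding ideal_component_def by (rule fs.span_add)
      then show ?thesis
        using h1(2) h2(2) by (intro bexI[of _ "h1 + h2"]) (auto simp: fun_apply distrib_left)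
    qed
    then show "p + q \<in> J" using p q polys_add unfolding J_def by blast
  next
    fix p q assume p: "p \<in> J" and q: "q \<in> polys V"
    obtain M1 where 1: "\<And>N. N \<ge> M1 \<Longrightarrow> \<exists>h\<in>ideal_component V T F d N. \<forall>x. x j \<noteq> 0 \<longrightarrow> x j ^ N * p (\<lambda>i. x i / x j) = h x"
      using p unfolding J_def by auto
    obtain M2 where 2: "\<And>N. N \<ge> M2 \<Longrightarrow> \<exists>h\<in>forms V N. \<forall>x. x j \<noteq> 0 \<longrightarrow> x j ^ N * q (\<lambda>i. x i / x j) = h x"
      using homogenize[OF V q] by auto
    have "\<exists>h\<in>ideal_component V T F d N. \<forall>x. x j \<noteq> 0 \<longrightarrow> x j ^ N * (q * p) (\<lambda>i. x i / x j) = h x"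
      if N: "N \<ge> M1 + M2" for N
    proof -
      obtain h1 where h1: "h1 \<in> ideal_component V T F d M1" "\<And>x. x j \<noteq> 0 \<Longrightarrow> x j ^ M1 * p (\<lambda>i. x i / x j) = h1 x"
        using 1[of M1] by auto
      obtain h2 where h2: "h2 \<in> forms V (N - M1)" "\<And>x. x j \<noteq> 0 \<Longrightarrow> x j ^ (N - M1) * q (\<lambda>i. x i / x j) = h2 x"
        using 2[of "N - M1"] N by force
      have "h1 * h2 \<in> ideal_component V T F d N" using ideal_component_mult[OF h1(1) h2(1)] N by simp
      moreover have "x j ^ N * (q (\<lambda>i. x i / x j) * p (\<lambda>i. x i / x j)) = h1 x * h2 x" if x: "x j \<noteq> 0" for x
      proof -
        have "x j ^ N = x j ^ M1 * x j ^ (N - M1)" using N by (simp flip: power_add)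
        then show ?thesis by (simp add: ac_simps flip: h1(2)[of x, OF x] h2(2)[of x, OF x])
      qed
      ultimately show ?thesis by (intro bexI[of _ "h1 * h2"]) (auto simp: fun_apply)
    qed
    then show "q * p \<in> J" using p q polys_mult unfolding J_def by blast
  qed
  have FJ: "F t \<in> J" if t: "t \<in> T" for t
  proof -
    have "\<exists>h\<in>ideal_component V T F d N. \<forall>x. x j \<noteq> 0 \<longrightarrow> x j ^ N * F t (\<lambda>i. x i / x j) = h x"
      if N: "N \<ge> d t" for N
    proof -
      \<comment> \<open>By homogeneity \<open>F t\<close> at \<open>x / x j\<close> is
        \<open>F t x\<close> divided by \<open>x j ^ d t\<close>, so a cofactor of degree
        \<open>N - d t\<close> remains.\<close>
      let ?g = "\<lambda>x. x j ^ (N - d t)"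
      have "F t * ?g \<in> ideal_component V T F d N"
        unfolding ideal_component_def using t N var_power_in_forms[OF V] by (intro fs.span_base) blast
      moreover have "x j ^ N * F t (\<lambda>i. x i / x j) = (F t * ?g) x" if "x j \<noteq> 0" for x
      proof -
        have e: "x j ^ N = x j ^ (N - d t) * x j ^ d t" using N by (simp flip: power_add)
        have "F t (\<lambda>i. x i / x j) = inverse (x j) ^ d t * F t x"
          using forms_homogeneous[OF F[OF t], of "inverse (x j)" x] by (simp add: divide_inverse mult.commute)
        then show ?thesis using that by (simp add: e fun_apply power_inverse)
      qed
      ultimately show ?thesis by blast
    qed
    then show ?thesis unfolding J_def using F[OF t] forms_subset_polys by blast
  qed
  \<comment> \<open>The homogenization is 0, as \<open>x j / x j = 1\<close>.\<close>
  have XJ: "(\<lambda>x. x j - 1) \<in> J"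
    unfolding J_def using linear_in_polys[OF V] zero
    by (auto simp: fun_apply intro!: exI[of _ 0] bexI[of _ 0])
  have "1 \<in> J"
  proof (rule ccontr)
    assume "1 \<notin> J"
    from weak_nullstellensatz[OF V(1) J this] obtain a where a: "\<forall>p\<in>J. p a = 0" ..
    have "a j - 1 = 0" using bspec[OF a XJ] .
    then obtain t where "t \<in> T" "F t a \<noteq> 0" using nozero[of a] by auto
    then show False using bspec[OF a FJ] by blast
  qed
  then obtain N h where h: "h \<in> ideal_component V T F d N"
    "\<And>x. x j \<noteq> 0 \<Longrightarrow> x j ^ N * 1 (\<lambda>i. x i / x j) = h x"
    unfolding J_def by auto
  \<comment> \<open>The identity for \<open>h\<close> is known only where
    \<open>x j \<noteq> 0\<close>; the extra factor \<open>x j\<close> makes both sides vanish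
    elsewhere.\<close>
  have "h * (\<lambda>x. x j) \<in> ideal_component V T F d (N + 1)"
    using ideal_component_mult[OF h(1) var_in_forms[OF V]] .
  also have "h * (\<lambda>x. x j) = (\<lambda>x. x j ^ (N + 1))"
  proof
    fix x show "(h * (\<lambda>x. x j)) x = x j ^ (N + 1)"
      using h(2)[of x] by (cases "x j = 0") (auto simp: fun_apply)
  qed
  finally show ?thesis by (rule exI)
qed

text \<open>Some power \<open>x j ^ M j\<close> of each variable lies in the ideal. A monomial of
  degree above the sum of the \<open>M j\<close> has an exponent exceeding its \<open>M j\<close>,
  hence is a multiple of that power.\<close>

lemma forms_subset_ideal:
  fixes T :: "'t set" and F :: "'t \<Rightarrow> (nat \<Rightarrow> complex) \<Rightarrow> complex"
  assumes V: "finite V" and F: "\<And>t. t \<in> T \<Longrightarrow> F t \<in> forms V (d t)"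
    and nozero: "\<And>a j. j \<in> V \<Longrightarrow> a j \<noteq> 0 \<Longrightarrow> \<exists>t\<in>T. F t a \<noteq> 0"
  shows "\<exists>K. \<forall>N\<ge>K. forms V N \<subseteq> ideal_component V T F d N"
proof -
  have "\<forall>j\<in>V. \<exists>N. (\<lambda>x. x j ^ N) \<in> ideal_component V T F d N"
  proof
    fix j assume "j \<in> V"
    with V F nozero[of j] show "\<exists>N. (\<lambda>x. x j ^ N) \<in> ideal_component V T F d N"
      by (intro var_power_in_ideal) auto
  qed
  from bchoice[OF this] obtain M
    where M: "\<And>j. j \<in> V \<Longrightarrow> (\<lambda>x. x j ^ M j) \<in> ideal_component V T F d (M j)"
    by auto
  have "monomial_fun V \<alpha> \<in> ideal_component V T F d N" if N: "N > sum M V" "sum \<alpha> V = N" for N \<alpha>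
  proof -
    have "\<exists>j\<in>V. M j < \<alpha> j" using N sum_mono[of V \<alpha> M] by (force simp: not_less)
    then obtain j where j: "j \<in> V" "M j \<le> \<alpha> j" by auto
    define \<beta> where "\<beta> = (\<lambda>i. if i = j then M j else 0)"
    have "sum \<beta> V = M j" using j V by (simp add: \<beta>_def)
    moreover have \<alpha>: "\<alpha> = (\<lambda>i. \<beta> i + (\<alpha> i - \<beta> i))" using j by (auto simp: \<beta>_def fun_eq_iff)
    have "sum \<alpha> V = sum \<beta> V + (\<Sum>i\<in>V. \<alpha> i - \<beta> i)"
      by (subst \<alpha>) (rule sum.distrib)
    ultimately have N': "M j + (\<Sum>i\<in>V. \<alpha> i - \<beta> i) = N" using N by simp
    have "(\<lambda>x. x j ^ M j) * monomial_fun V (\<lambda>i. \<alpha> i - \<beta> i) \<in> ideal_component V T F d (M j + (\<Sum>i\<in>V. \<alpha> i - \<beta> i))"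
      by (rule ideal_component_mult[OF M[OF j(1)] monomial_fun_in_forms])
    also have "(\<lambda>x. x j ^ M j) = monomial_fun V \<beta>"
      unfolding \<beta>_def by (rule var_power_monomial[OF V j(1)])
    also have "monomial_fun V \<beta> * monomial_fun V (\<lambda>i. \<alpha> i - \<beta> i) = monomial_fun V \<alpha>"
      unfolding monomial_fun_mult by (simp flip: \<alpha>)
    finally show ?thesis unfolding N' .
  qed
  then have "forms V N \<subseteq> ideal_component V T F d N" if "N \<ge> Suc (sum M V)" for N
    unfolding forms_def using that by (intro fs.span_minimal) (auto simp: ideal_component_def)
  then show ?thesis by blast
qed

section \<open>Dimension count on a grid\<close>

text \<open>Lagrange interpolation in every coordinate: the factors
  \<open>(x j - k) / (g j - k)\<close> with \<open>k \<noteq> g j\<close> kill all grid points other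
  than \<open>g\<close>. There are \<open>e\<close> of them for each coordinate, whence the degree
  bound.\<close>

lemma grid_delta:
  assumes V: "finite V" and g: "g \<in> V \<rightarrow>\<^sub>E {0..e}"
  shows "\<exists>p\<in>polys_upto V (card V * e). \<forall>h\<in>V \<rightarrow>\<^sub>E {0..e}.
    p (\<lambda>j. of_nat (h j)) = (if h = g then 1 else 0)"
proof -
  define L where "L = (\<lambda>j k x. (x j - of_nat k) / (of_nat (g j) - of_nat k) :: complex)"
  define p where "p = (\<Prod>j\<in>V. \<Prod>k\<in>{0..e} - {g j}. L j k)"
  have "L j k \<in> polys_upto V 1" if "j \<in> V" for j k
  proof -
    let ?c = "inverse (of_nat (g j) - of_nat k) :: complex"
    have "monomial_fun V (\<lambda>i. if i = j then 1 else 0) \<in> polys_upto V 1"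
      unfolding polys_upto_def using V that by (intro fs.span_base CollectI exI conjI refl) auto
    then have "(\<lambda>x. x j ^ 1) \<in> polys_upto V 1"
      unfolding var_power_monomial[OF V that, of 1] .
    then have "cscale ?c (\<lambda>x. x j ^ 1) + (\<lambda>_. - ?c * of_nat k) \<in> polys_upto V 1"
      using const_in_polys_upto[of "- ?c * of_nat k" V 1]
      unfolding polys_upto_def by (intro fs.span_add fs.span_scale)
    also have "cscale ?c (\<lambda>x. x j ^ 1) + (\<lambda>_. - ?c * of_nat k) = L j k"
      by (auto simp: fun_eq_iff fun_apply L_def divide_inverse algebra_simps)
    finally show ?thesis .
  qed
  then have "p \<in> polys_upto V (\<Sum>j\<in>V. \<Sum>k\<in>{0..e} - {g j}. 1)"
    unfolding p_def by (intro polys_upto_prod)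
  also have "(\<Sum>j\<in>V. \<Sum>k\<in>{0..e} - {g j}. 1) = (\<Sum>j\<in>V. e)"
    using g by (intro sum.cong) (auto simp: PiE_def Pi_def)
  finally have "p \<in> polys_upto V (card V * e)" by simp
  moreover have "p (\<lambda>j. of_nat (h j)) = (if h = g then 1 else 0)" if h: "h \<in> V \<rightarrow>\<^sub>E {0..e}" for h
  proof (cases "h = g")
    case True
    then show ?thesis by (auto simp: p_def fun_prod_apply L_def intro!: prod.neutral)
  next
    case False
    then obtain j where j: "j \<in> V" "h j \<noteq> g j" using h g by (metis PiE_ext)
    then have "L j (h j) (\<lambda>j. of_nat (h j)) = 0" "h j \<in> {0..e} - {g j}"
      using h by (auto simp: L_def)
    then have "(\<Prod>k\<in>{0..e} - {g j}. L j k (\<lambda>j. of_nat (h j))) = 0" by (intro prod_zero) auto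
    then show ?thesis using False j V by (auto simp: p_def fun_prod_apply intro!: prod_zero)
  qed
  ultimately show ?thesis by blast
qed

lemma forms_common_zero:
  fixes T :: "'t set" and F :: "'t \<Rightarrow> (nat \<Rightarrow> complex) \<Rightarrow> complex"
  assumes V: "finite V" and T: "finite T" and card: "card T < card V"
    and F: "\<And>t. t \<in> T \<Longrightarrow> F t \<in> forms V (d t)" and d: "\<And>t. t \<in> T \<Longrightarrow> d t > 0"
  shows "\<exists>a. (\<exists>j\<in>V. a j \<noteq> 0) \<and> (\<forall>t\<in>T. F t a = 0)"
proof (rule ccontr)
  assume "\<not> ?thesis"
  then have "\<exists>K. \<forall>N\<ge>K. forms V N \<subseteq> ideal_component V T F d N"
    by (intro forms_subset_ideal V F) auto
  then obtain K where K: "\<And>N. N \<ge> K \<Longrightarrow> forms V N \<subseteq> ideal_component V T F d N" by blast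
  \<comment> \<open>\<open>pw \<beta>\<close> is a monomial in the given forms. \<open>B N\<close>
    bounds each exponent separately instead of the total degree; this can only enlarge the span, and
    the size is then at most \<open>card U * (N + 1) ^ card T\<close>.\<close>
  define pw where "pw = (\<lambda>\<beta>. \<Prod>t\<in>T. F t ^ \<beta> t)"
  define U where "U = {monomial_fun V \<alpha> | \<alpha>. sum \<alpha> V \<le> K}"
  define B where "B = (\<lambda>N. (\<lambda>(u, \<beta>). u * pw \<beta>) ` (U \<times> (T \<rightarrow>\<^sub>E {0..N})))"
  have B_mono: "B a \<subseteq> B b" if "a \<le> b" for a b
    unfolding B_def using that by (intro image_mono Sigma_mono PiE_mono) auto
  have fT: "F t * b \<in> B (Suc N)" if t: "t \<in> T" and b: "b \<in> B N" for t b N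
  proof -
    obtain u \<beta> where b: "b = u * pw \<beta>" "u \<in> U" "\<beta> \<in> T \<rightarrow>\<^sub>E {0..N}" using b unfolding B_def by auto
    have "F t * pw \<beta> = pw (\<beta>(t := Suc (\<beta> t)))"
    proof -
      have "pw (\<beta>(t := Suc (\<beta> t))) = F t ^ Suc (\<beta> t) * (\<Prod>s\<in>T - {t}. F s ^ \<beta> s)"
        unfolding pw_def prod.remove[OF T t] by (intro arg_cong2[of _ _ _ _ "(*)"] prod.cong) auto
      then show ?thesis unfolding pw_def prod.remove[OF T t] by (simp add: mult.assoc)
    qed
    then have "F t * b = u * pw (\<beta>(t := Suc (\<beta> t)))" using b by (simp add: mult.left_commute)
    moreover have "\<beta>(t := Suc (\<beta> t)) \<in> T \<rightarrow>\<^sub>E {0..Suc N}"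
      using b(3) t by (auto simp: PiE_def Pi_def extensional_def le_Suc_eq)
    ultimately show ?thesis unfolding B_def using b(2) by force
  qed
  \<comment> \<open>Below degree \<open>K\<close> the monomials in \<open>U\<close> suffice. From
    \<open>K\<close> on, a form is a combination of products \<open>F t * h\<close>; as
    \<open>d t > 0\<close>, the degree of \<open>h\<close> is smaller, and the factor
    \<open>F t\<close> raises just one exponent by 1.\<close>
  have forms_span: "forms V N \<subseteq> fs.span (B N)" for N
  proof (induction N rule: less_induct)
    case (less N)
    show ?case
    proof (cases "N < K")
      case True
      \<comment> \<open>Members of \<open>T \<rightarrow>\<^sub>E {0..N}\<close> are
        \<open>undefined\<close> outside \<open>T\<close>, so the zero exponent has to be
        restricted.\<close>
      have "pw (restrict (\<lambda>_. 0) T) = 1" by (simp add: pw_def)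
      then have UB: "u \<in> B N" if "u \<in> U" for u
        unfolding B_def using that
        by (intro image_eqI[of _ _ "(u, restrict (\<lambda>_. 0) T)"]) auto
      have "{monomial_fun V \<alpha> | \<alpha>. sum \<alpha> V = N} \<subseteq> U" using True unfolding U_def by auto
      then show ?thesis unfolding forms_def using UB by (intro fs.span_mono) blast
    next
      case False
      have "F t * h \<in> fs.span (B N)" if t: "t \<in> T" "d t \<le> N" "h \<in> forms V (N - d t)" for t h
      proof -
        have "N - d t < N" using d[OF t(1)] t(2) by simp
        then have h: "h \<in> fs.span (B (N - d t))" using less.IH t(3) by blast
        have Ft: "F t \<in> fs.span {F t}" by (simp add: fs.span_base)
        have "B (Suc (N - d t)) \<subseteq> B N" using \<open>N - d t < N\<close> by (intro B_mono) simp
        show ?thesis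
        proof (rule span_times[OF Ft h])
          fix s b assume "s \<in> {F t}" "b \<in> B (N - d t)"
          then have "s * b \<in> B (Suc (N - d t))" using fT[OF t(1)] by simp
          then show "s * b \<in> fs.span (B N)"
            using \<open>B (Suc (N - d t)) \<subseteq> B N\<close> by (intro fs.span_base) blast
        qed
      qed
      then have "ideal_component V T F d N \<subseteq> fs.span (B N)"
        unfolding ideal_component_def by (intro fs.span_minimal) auto
      then show ?thesis using K[of N] False by auto
    qed
  qed
  have polys_span: "polys_upto V N \<subseteq> fs.span (B N)" for N
    unfolding polys_upto_def
  proof (intro fs.span_minimal subsetI)
    fix p assume "p \<in> {monomial_fun V \<alpha> |\<alpha>. sum \<alpha> V \<le> N}"
    then obtain \<alpha> where \<alpha>: "p = monomial_fun V \<alpha>" "sum \<alpha> V \<le> N" by auto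
    then show "p \<in> fs.span (B N)"
      using forms_span[of "sum \<alpha> V"] monomial_fun_in_forms[of V \<alpha>] fs.span_mono[OF B_mono[OF \<alpha>(2)]] by blast
  qed simp
  have U: "finite U" unfolding U_def by (rule finite_monomials[OF V])
  have finB: "finite (B N)" for N
    unfolding B_def using U T by (intro finite_imageI finite_cartesian_product finite_PiE) auto
  have cardB: "card (B N) \<le> card U * Suc N ^ card T" for N
  proof -
    have "card (B N) \<le> card (U \<times> (T \<rightarrow>\<^sub>E {0..N}))"
      unfolding B_def using U T by (intro card_image_le finite_cartesian_product finite_PiE) auto
    also have "\<dots> = card U * Suc N ^ card T"
      using T by (simp add: card_cartesian_product card_PiE)
    finally show ?thesis .
  qed
  define m where "m = card V"
  have m: "m > 0" using card by (simp add: m_def)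
  \<comment> \<open>Chosen so that, with \<open>r = card T\<close> and \<open>N = m * e\<close> (the
    degree of the interpolating polynomials), \<open>card U * (N + 1) ^ r\<close> is at most
    \<open>card U * (m * (e + 1)) ^ r = e * (e + 1) ^ r\<close>. This is below
    \<open>(e + 1) ^ m\<close>, the number of grid points.\<close>
  define e where "e = card U * m ^ card T"
  have "card (B (m * e)) \<le> card U * Suc (m * e) ^ card T" by (rule cardB)
  also have "\<dots> \<le> card U * (m * Suc e) ^ card T"
    using m by (intro mult_left_mono power_mono) auto
  also have "\<dots> = e * Suc e ^ card T" by (simp only: e_def power_mult_distrib mult.assoc)
  also have "\<dots> < Suc e ^ Suc (card T)" by simp
  also have "\<dots> \<le> Suc e ^ m" using card unfolding m_def by (intro power_increasing) auto
  also have "\<dots> = card (V \<rightarrow>\<^sub>E {0..e})" using V by (simp add: m_def card_PiE)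
  finally have less: "card (B (m * e)) < card (V \<rightarrow>\<^sub>E {0..e})" .
  have fin: "finite (V \<rightarrow>\<^sub>E {0..e})" using V by (intro finite_PiE) auto
  have "\<forall>g\<in>V \<rightarrow>\<^sub>E {0..e}. \<exists>p. p \<in> polys_upto V (m * e) \<and> (\<forall>h\<in>V \<rightarrow>\<^sub>E {0..e}.
    p (\<lambda>j. of_nat (h j)) = (if h = g then 1 else 0))"
    using grid_delta[OF V] unfolding m_def by blast
  from bchoice[OF this] obtain \<delta> where \<delta>: "\<And>g. g \<in> V \<rightarrow>\<^sub>E {0..e} \<Longrightarrow> \<delta> g \<in> polys_upto V (m * e)"
    "\<And>g h. g \<in> V \<rightarrow>\<^sub>E {0..e} \<Longrightarrow> h \<in> V \<rightarrow>\<^sub>E {0..e} \<Longrightarrow> \<delta> g (\<lambda>j. of_nat (h j)) = (if h = g then 1 else 0)"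
    by blast
  have "\<delta> ` (V \<rightarrow>\<^sub>E {0..e}) \<subseteq> fs.span (B (m * e))"
    using \<delta>(1) polys_span by blast
  then obtain u where u: "\<exists>g\<in>V \<rightarrow>\<^sub>E {0..e}. u g \<noteq> 0" "\<And>x. (\<Sum>g\<in>V \<rightarrow>\<^sub>E {0..e}. u g * \<delta> g x) = 0"
    using exists_linear_relation[OF finB fin less] by blast
  obtain h where h: "h \<in> V \<rightarrow>\<^sub>E {0..e}" "u h \<noteq> 0" using u(1) by blast
  \<comment> \<open>At the grid point \<open>h\<close> every interpolating polynomial except
    \<open>\<delta> h\<close> vanishes, which isolates \<open>u h\<close>.\<close>
  have "(\<Sum>g\<in>V \<rightarrow>\<^sub>E {0..e}. u g * \<delta> g (\<lambda>j. of_nat (h j))) = (\<Sum>g\<in>V \<rightarrow>\<^sub>E {0..e}. if g = h then u g else 0)"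
    using \<delta>(2) h(1) by (intro sum.cong) auto
  also have "\<dots> = u h" using h fin by simp
  finally show False using u(2) h(2) by simp
qed

section \<open>Divisibility by the factorial\<close>

lemma multiplicity_eq_card_powers:
  fixes p x :: nat
  assumes p: "prime p" and x: "x > 0" and B: "x < p ^ B"
  shows "multiplicity p x = card {j \<in> {1..B}. p ^ j dvd x}"
proof -
  have p1: "\<not> is_unit p" "x \<noteq> 0" using p x not_prime_1 by auto
  have "multiplicity p x \<le> B"
  proof (rule ccontr)
    assume "\<not> multiplicity p x \<le> B"
    then have "p ^ B dvd x" using p1 by (simp add: power_dvd_iff_le_multiplicity)
    then show False using x B by (auto dest: dvd_imp_le)
  qed
  then have "{j \<in> {1..B}. p ^ j dvd x} = {1..multiplicity p x}"
    using p1 by (auto simp: power_dvd_iff_le_multiplicity)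
  then show ?thesis by simp
qed

text \<open>Legendre's formula, by double counting the pairs \<open>(i, j)\<close> with
  \<open>p ^ j dvd d i\<close>. It serves for the degrees as well as for the factors of the
  factorial.\<close>

lemma multiplicity_prod_eq_sum_card:
  fixes p :: nat and d :: "nat \<Rightarrow> nat"
  assumes p: "prime p" and I: "finite I" and d: "\<And>i. i \<in> I \<Longrightarrow> 0 < d i \<and> d i < p ^ B"
  shows "multiplicity p (\<Prod>i\<in>I. d i) = (\<Sum>j\<in>{1..B}. card {i \<in> I. p ^ j dvd d i})"
proof -
  have "0 \<notin> d ` I" using d by fastforce
  then have "multiplicity p (\<Prod>i\<in>I. d i) = (\<Sum>i\<in>I. multiplicity p (d i))"
    using p I by (intro prime_elem_multiplicity_prod_distrib) auto
  also have "\<dots> = (\<Sum>i\<in>I. card {j \<in> {1..B}. p ^ j dvd d i})"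
    using d by (intro sum.cong multiplicity_eq_card_powers[OF p]) auto
  also have "\<dots> = (\<Sum>j\<in>{1..B}. card {i \<in> I. p ^ j dvd d i})"
    using sum_multicount_gen[of I "{1..B}" "\<lambda>i j. p ^ j dvd d i" "\<lambda>j. card {i \<in> I. p ^ j dvd d i}"] I
    by simp
  finally show ?thesis .
qed

lemma card_multiples: 
  assumes "k > 0" shows "card {i \<in> {1..n}. k dvd i} = n div (k::nat)"
proof -
  have "{i \<in> {1..n}. k dvd i} = (\<lambda>q. k * q) ` {1..n div k}"
  proof (intro equalityI subsetI)
    fix i assume "i \<in> {i \<in> {1..n}. k dvd i}"
    then obtain q where q: "i = k * q" "1 \<le> k * q" "k * q \<le> n" by (auto elim!: dvdE)
    then have "q \<in> {1..n div k}"
      using assms by (cases "q = 0") (auto simp: less_eq_div_iff_mult_less_eq mult.commute)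
    then show "i \<in> (\<lambda>q. k * q) ` {1..n div k}" using q by blast
  qed (use assms in \<open>auto simp: less_eq_div_iff_mult_less_eq mult.commute\<close>)
  moreover have "inj_on (\<lambda>q. k * q) {1..n div k}" using assms by (auto simp: inj_on_def)
  ultimately show ?thesis by (simp add: card_image)
qed

text \<open>Exactly \<open>n div k\<close> of the numbers from 1 to \<open>n\<close> are multiples
  of \<open>k\<close>. Taking \<open>k = p ^ j\<close> compares the two Legendre sums term by
  term.\<close>

lemma fact_dvd_prod_if_enough_multiples:
  fixes d :: "nat \<Rightarrow> nat"
  assumes d: "\<And>i. i \<in> {1..n} \<Longrightarrow> d i > 0"
    and le: "\<And>k. k > 0 \<Longrightarrow> n div k \<le> card {i \<in> {1..n}. k dvd d i}"
  shows "fact n dvd (\<Prod>i\<in>{1..n}. d i)"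
proof (rule multiplicity_le_imp_dvd)
  fix p :: nat assume p: "prime p"
  \<comment> \<open>One bound for both products: all their factors are at most \<open>B\<close>, and
    \<open>B < p ^ B\<close>.\<close>
  define B where "B = n + (\<Sum>i\<in>{1..n}. d i)"
  have B: "B < p ^ B" using prime_gt_1_nat[OF p] by (intro power_gt_expt) simp
  have "multiplicity p (fact n) = multiplicity p (\<Prod>i\<in>{1..n}. i)" by (simp add: fact_prod)
  also have "\<dots> = (\<Sum>j\<in>{1..B}. card {i \<in> {1..n}. p ^ j dvd i})"
    using B by (intro multiplicity_prod_eq_sum_card[OF p]) (auto simp: B_def)
  also have "\<dots> \<le> (\<Sum>j\<in>{1..B}. card {i \<in> {1..n}. p ^ j dvd d i})"
    using prime_gt_0_nat[OF p] le by (intro sum_mono) (simp only: card_multiples zero_less_power)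
  also have "\<dots> = multiplicity p (\<Prod>i\<in>{1..n}. d i)"
  proof (rule multiplicity_prod_eq_sum_card[OF p, symmetric])
    fix i assume i: "i \<in> {1..n}"
    then have "d i \<le> (\<Sum>i\<in>{1..n}. d i)" by (intro member_le_sum) auto
    then show "0 < d i \<and> d i < p ^ B" using B d[OF i] by (simp add: B_def)
  qed simp
  finally show "multiplicity p (fact n) \<le> multiplicity p (\<Prod>i\<in>{1..n}. d i)" .
qed simp

section \<open>Symmetric forms on orbits of roots of unity\<close>

lemma homogeneous_degree:
  assumes "homogeneous p" "total_degree p > 0" "m \<in> Poly_Mapping.keys p"
  shows "mono_degree m = total_degree p"
proof -
  obtain d where d: "\<And>m. m \<in> Poly_Mapping.keys p \<Longrightarrow> mono_degree m = d"
    using assms(1) unfolding homogeneous_def by blast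
  then have "mono_degree ` Poly_Mapping.keys p = {d}" using assms(3) by force
  then have "total_degree p = max 0 d" unfolding total_degree_def by simp
  then show ?thesis using d[OF assms(3)] by simp
qed

text \<open>Each monomial of degree \<open>d\<close> becomes a constant times a product of
  \<open>d\<close> linear forms. This carries formal polynomials over to the function spaces
  \<open>forms\<close>.\<close>

lemma poly_eval_comp_in_forms:
  assumes L: "\<And>i. (\<lambda>y. L y i) \<in> forms V 1"
    and deg: "\<And>m. m \<in> Poly_Mapping.keys p \<Longrightarrow> mono_degree m = d"
  shows "(\<lambda>y. poly_eval (L y) p) \<in> forms V d"
proof -
  have "cscale (Poly_Mapping.lookup p m) (\<Prod>i\<in>Poly_Mapping.keys m. (\<lambda>y. L y i) ^ Poly_Mapping.lookup m i) \<in> forms V d"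
    if m: "m \<in> Poly_Mapping.keys p" for m
  proof -
    have "(\<Prod>i\<in>Poly_Mapping.keys m. (\<lambda>y. L y i) ^ Poly_Mapping.lookup m i)
        \<in> forms V (\<Sum>i\<in>Poly_Mapping.keys m. Poly_Mapping.lookup m i * 1)"
      by (intro forms_prod forms_power L)
    then show ?thesis
      using deg[OF m] unfolding forms_def mono_degree_def by (intro fs.span_scale) simp
  qed
  then have "(\<Sum>m\<in>Poly_Mapping.keys p. cscale (Poly_Mapping.lookup p m)
      (\<Prod>i\<in>Poly_Mapping.keys m. (\<lambda>y. L y i) ^ Poly_Mapping.lookup m i)) \<in> forms V d"
    unfolding forms_def by (rule fs.span_sum)
  also have "(\<Sum>m\<in>Poly_Mapping.keys p. cscale (Poly_Mapping.lookup p m)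
      (\<Prod>i\<in>Poly_Mapping.keys m. (\<lambda>y. L y i) ^ Poly_Mapping.lookup m i)) = (\<lambda>y. poly_eval (L y) p)"
    by (rule ext) (simp add: poly_eval_def fun_sum_apply fun_prod_apply fun_power_apply fun_apply)
  finally show ?thesis .
qed

lemma poly_eval_scale:
  assumes "\<And>m. m \<in> Poly_Mapping.keys p \<Longrightarrow> mono_degree m = d"
  shows "poly_eval (\<lambda>i. c * a i) p = c ^ d * poly_eval a p"
proof -
  have "(\<Prod>i\<in>Poly_Mapping.keys m. (c * a i) ^ Poly_Mapping.lookup m i)
      = c ^ d * (\<Prod>i\<in>Poly_Mapping.keys m. a i ^ Poly_Mapping.lookup m i)"
    if "m \<in> Poly_Mapping.keys p" for m
    using assms[OF that] by (simp add: power_mult_distrib prod.distrib mono_degree_def flip: power_sum)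
  then show ?thesis unfolding poly_eval_def sum_distrib_left
    by (intro sum.cong) simp_all
qed

lemma inj_map_key:
  assumes "bij \<sigma>" shows "inj (Poly_Mapping.map_key \<sigma> :: ('a \<Rightarrow>\<^sub>0 'b::zero) \<Rightarrow> ('a \<Rightarrow>\<^sub>0 'b))"
proof (rule injI)
  fix p q :: "'a \<Rightarrow>\<^sub>0 'b" assume eq: "Poly_Mapping.map_key \<sigma> p = Poly_Mapping.map_key \<sigma> q"
  show "p = q"
  proof (rule poly_mapping_eqI)
    fix i
    have "Poly_Mapping.lookup (Poly_Mapping.map_key \<sigma> p) (inv \<sigma> i)
        = Poly_Mapping.lookup (Poly_Mapping.map_key \<sigma> q) (inv \<sigma> i)" using eq by simp
    then show "Poly_Mapping.lookup p i = Poly_Mapping.lookup q i"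
      using assms by (simp add: map_key.rep_eq bij_is_inj bij_is_surj surj_f_inv_f)
  qed
qed

text \<open>The sum is reindexed along \<open>h\<close>, which sends \<open>m\<close> to
  \<open>m \<circ> \<sigma>\<close>: by symmetry it preserves coefficients, and the monomial
  \<open>h m\<close> takes at \<open>a \<circ> \<sigma>\<close> the value of \<open>m\<close> at
  \<open>a\<close>.\<close>

lemma poly_eval_permute:
  assumes p: "symmetric_poly n p" and \<sigma>: "\<sigma> permutes {1..n}"
  shows "poly_eval (\<lambda>i. a (\<sigma> i)) p = poly_eval a p"
proof -
  have bij: "bij \<sigma>" using \<sigma> by (rule permutes_bij)
  define h where "h = (Poly_Mapping.map_key \<sigma> :: monomial \<Rightarrow> monomial)"
  have inj: "inj h" unfolding h_def by (rule inj_map_key[OF bij])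
  have ph: "Poly_Mapping.lookup p (h m) = Poly_Mapping.lookup p m" for m
  proof -
    have "Poly_Mapping.map_key h p = p"
      using p \<sigma> unfolding symmetric_poly_def permute_vars_def h_def by blast
    then have "Poly_Mapping.lookup (Poly_Mapping.map_key h p) m = Poly_Mapping.lookup p m" by simp
    then show ?thesis by (simp add: map_key.rep_eq[OF inj])
  qed
  \<comment> \<open>The support is finite, so an injective map of it into itself is onto.\<close>
  have "h ` Poly_Mapping.keys p \<subseteq> Poly_Mapping.keys p" using ph by (auto simp: in_keys_iff)
  then have hp: "h ` Poly_Mapping.keys p = Poly_Mapping.keys p"
    using inj_on_subset[OF inj subset_UNIV] by (intro endo_inj_surj) auto
  have mon: "(\<Prod>i\<in>Poly_Mapping.keys (h m). a (\<sigma> i) ^ Poly_Mapping.lookup (h m) i)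
      = (\<Prod>i\<in>Poly_Mapping.keys m. a i ^ Poly_Mapping.lookup m i)" for m
  proof -
    have 1: "Poly_Mapping.keys m = \<sigma> ` Poly_Mapping.keys (h m)"
      using bij unfolding h_def by (simp add: keys_map_key bij_is_inj bij_is_surj surj_image_vimage_eq)
    have 2: "Poly_Mapping.lookup (h m) i = Poly_Mapping.lookup m (\<sigma> i)" for i
      using bij unfolding h_def by (simp add: map_key.rep_eq bij_is_inj)
    show ?thesis unfolding 1 2
      using inj_on_subset[OF bij_is_inj[OF bij] subset_UNIV] by (subst prod.reindex) auto
  qed
  have "poly_eval (\<lambda>i. a (\<sigma> i)) p = (\<Sum>m\<in>h ` Poly_Mapping.keys p. Poly_Mapping.lookup p m
      * (\<Prod>i\<in>Poly_Mapping.keys m. a (\<sigma> i) ^ Poly_Mapping.lookup m i))"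
    unfolding poly_eval_def hp ..
  also have "\<dots> = poly_eval a p"
    using inj_on_subset[OF inj subset_UNIV] by (subst sum.reindex) (auto simp: poly_eval_def ph mon)
  finally show ?thesis .
qed

section \<open>Roots of unity and cyclic shifts\<close>

lemma primitive_root_of_unity:
  assumes "k > 0"
  obtains \<omega> :: complex where "\<omega> ^ k = 1" "\<And>d. \<omega> ^ d = 1 \<Longrightarrow> k dvd d"
proof -
  define \<omega> where "\<omega> = cis (2 * pi / k)"
  have pw: "\<omega> ^ d = cis (2 * pi * real d / real k)" for d
    by (simp add: \<omega>_def DeMoivre mult.commute)
  have 1: "\<omega> ^ k = 1" using assms by (simp add: pw)
  have "k dvd d" if "\<omega> ^ d = 1" for d
  proof -
    \<comment> \<open>Reducing the exponent modulo \<open>k\<close> brings it into the range where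
      the \<open>k\<close>-th roots of unity are pairwise distinct.\<close>
    have "\<omega> ^ d = (\<omega> ^ k) ^ (d div k) * \<omega> ^ (d mod k)" by (simp flip: power_mult power_add)
    then have "\<omega> ^ (d mod k) = \<omega> ^ 0" using that 1 by simp
    then have "cis (2 * pi * real (d mod k) / real k) = cis (2 * pi * real 0 / real k)" by (simp only: pw)
    then have "d mod k = 0"
      by (rule inj_onD[OF bij_betw_imp_inj_on[OF bij_betw_roots_unity[OF assms]]]) (use assms in auto)
    then show ?thesis by auto
  qed
  with 1 that show thesis by blast
qed

text \<open>
  The coordinate \<open>\<omega>\<^sup>s y\<^sub>q\<close> is put at position \<open>s m + q + 1\<close>, which makes multiplication by \<open>\<omega>\<close> a cyclic
  shift by \<open>m\<close> of the first \<open>m k\<close> coordinates.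
\<close>

definition orbit_point :: "complex \<Rightarrow> nat \<Rightarrow> nat \<Rightarrow> (nat \<Rightarrow> complex) \<Rightarrow> nat \<Rightarrow> complex" where
  "orbit_point \<omega> k m y i = (if i \<in> {1..m * k} then \<omega> ^ ((i - 1) div m) * y ((i - 1) mod m) else 0)"

lemma orbit_point_in_forms:
  assumes "m > 0" shows "(\<lambda>y. orbit_point \<omega> k m y i) \<in> forms {..<m} 1"
proof (cases "i \<in> {1..m * k}")
  case True
  have "cscale (\<omega> ^ ((i - 1) div m)) (\<lambda>y. y ((i - 1) mod m)) \<in> forms {..<m} 1"
    using var_in_forms[of "{..<m}" "(i - 1) mod m"] assms unfolding forms_def by (intro fs.span_scale) simp
  then show ?thesis using True by (simp add: orbit_point_def cscale_def)
next
  case False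
  have "(\<lambda>y. orbit_point \<omega> k m y i) = 0" using False by (auto simp: orbit_point_def fun_eq_iff fun_apply)
  then show ?thesis unfolding forms_def by (simp add: fs.span_zero)
qed

text \<open>The shift raises the block index \<open>s\<close> by one and keeps \<open>q\<close>; the
  wrap from the last block to the first is harmless because \<open>\<omega> ^ k = 1\<close>.
  Positions outside the blocks are fixed and carry 0 on both sides.\<close>

lemma orbit_point_rotate:
  assumes \<omega>: "\<omega> ^ k = 1" and n: "m * k \<le> n"
  obtains \<sigma> where "\<sigma> permutes {1..n}" "\<And>i. orbit_point \<omega> k m y (\<sigma> i) = \<omega> * orbit_point \<omega> k m y i"
proof -
  \<comment> \<open>Positions start at 1, so the shift modulo \<open>m * k\<close> acts on
    \<open>i - 1\<close>.\<close>
  define \<sigma> where "\<sigma> = (\<lambda>i. if i \<in> {1..m * k} then (i - 1 + m) mod (m * k) + 1 else i)"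
  have in_range: "\<sigma> i \<in> {1..m * k}" if "i \<in> {1..m * k}" for i
  proof -
    have "0 < m * k" using that unfolding atLeastAtMost_iff by linarith
    then have "(i - 1 + m) mod (m * k) < m * k" by (rule mod_less_divisor)
    then show ?thesis using that by (auto simp: \<sigma>_def)
  qed
  have "inj_on \<sigma> {1..m * k}"
  proof (rule inj_onI)
    fix i j assume ij: "i \<in> {1..m * k}" "j \<in> {1..m * k}" "\<sigma> i = \<sigma> j"
    then have "(i - 1 + m) mod (m * k) = (j - 1 + m) mod (m * k)" by (simp add: \<sigma>_def)
    then have "(i - 1) mod (m * k) = (j - 1) mod (m * k)" by (simp add: nat_mod_eq_iff)
    then show "i = j" using ij by auto
  qed
  moreover have "\<sigma> ` {1..m * k} \<subseteq> {1..m * k}" using in_range by blast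
  ultimately have "bij_betw \<sigma> {1..m * k} {1..m * k}"
    by (simp add: bij_betw_def endo_inj_surj)
  then have "\<sigma> permutes {1..m * k}"
    by (rule bij_imp_permutes) (simp only: \<sigma>_def if_False)
  then have "\<sigma> permutes {1..n}" by (rule permutes_subset) (use n in auto)
  moreover have "orbit_point \<omega> k m y (\<sigma> i) = \<omega> * orbit_point \<omega> k m y i" for i
  proof (cases "i \<in> {1..m * k}")
    case True
    then have m: "m > 0" by (cases m) auto
    define j where "j = i - 1"
    have "\<sigma> i - 1 = (j + m) mod (m * k)" using True by (simp add: \<sigma>_def j_def)
    then have e: "\<sigma> i - 1 = m * ((j div m + 1) mod k) + j mod m" using m by (simp add: mod_mult2_eq)
    have "(\<sigma> i - 1) div m = (j div m + 1) mod k" "(\<sigma> i - 1) mod m = j mod m"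
      unfolding e using m by simp_all
    moreover have "\<omega> ^ (t mod k) = \<omega> ^ t" for t
    proof -
      have "\<omega> ^ t = (\<omega> ^ k) ^ (t div k) * \<omega> ^ (t mod k)" by (simp flip: power_mult power_add)
      then show ?thesis using \<omega> by simp
    qed
    ultimately show ?thesis using True in_range[OF True] by (simp add: orbit_point_def j_def)
  next
    case False
    moreover from this have "\<sigma> i = i" unfolding \<sigma>_def by (rule if_not_P)
    ultimately show ?thesis by (simp only: orbit_point_def if_False mult_zero_right)
  qed
  ultimately show thesis using that by blast
qed

section \<open>Counting the degrees divisible by \<open>k\<close>\<close>

theorem lemma2p8:
  fixes n :: nat and f :: "nat \<Rightarrow> cpoly"
  assumes "n \<ge> 1"
    and "\<And>i. i \<in> {1..n} \<Longrightarrow> f i \<in> poly_ring n"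
    and "\<And>i. i \<in> {1..n} \<Longrightarrow> homogeneous (f i)"
    and "\<And>i. i \<in> {1..n} \<Longrightarrow> symmetric_poly n (f i)"
    and "regular_sequence n f"
  shows "(fact n :: nat) dvd (\<Prod>i\<in>{1..n}. total_degree (f i))"
proof (rule fact_dvd_prod_if_enough_multiples)
  show pos: "total_degree (f i) > 0" if "i \<in> {1..n}" for i
    using assms(5) that unfolding regular_sequence_def by blast
  have deg: "mono_degree m = total_degree (f i)" if "i \<in> {1..n}" "m \<in> Poly_Mapping.keys (f i)" for i m
    using homogeneous_degree[OF assms(3) pos] that by blast
  fix k :: nat assume k: "k > 0"
  define m where "m = n div k"
  have mk: "m * k \<le> n" by (simp add: m_def)
  define T where "T = {i \<in> {1..n}. k dvd total_degree (f i)}"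
  obtain \<omega> :: complex where \<omega>: "\<omega> ^ k = 1" "\<And>d. \<omega> ^ d = 1 \<Longrightarrow> k dvd d"
    using primitive_root_of_unity[OF k] by blast
  have "m \<le> card T"
  proof (rule ccontr)
    assume less: "\<not> m \<le> card T"
    then have m: "m > 0" by simp
    \<comment> \<open>On orbit points the polynomials indexed by \<open>T\<close> become fewer than
      \<open>m\<close> forms in \<open>m\<close> variables.\<close>
    have "\<exists>a. (\<exists>j\<in>{..<m}. a j \<noteq> 0) \<and> (\<forall>i\<in>T. poly_eval (orbit_point \<omega> k m a) (f i) = 0)"
    proof (rule forms_common_zero)
      show "(\<lambda>y. poly_eval (orbit_point \<omega> k m y) (f i)) \<in> forms {..<m} (total_degree (f i))" if "i \<in> T" for i
        using that deg by (intro poly_eval_comp_in_forms orbit_point_in_forms m) (auto simp: T_def)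
    qed (use less pos in \<open>auto simp: T_def\<close>)
    then obtain a j where a: "j < m" "a j \<noteq> 0" "\<And>i. i \<in> T \<Longrightarrow> poly_eval (orbit_point \<omega> k m a) (f i) = 0"
      by auto
    have "poly_eval (orbit_point \<omega> k m a) (f i) = 0" if i: "i \<in> {1..n}" for i
    proof (cases "i \<in> T")
      case False
      obtain \<sigma> where \<sigma>: "\<sigma> permutes {1..n}"
        "\<And>l. orbit_point \<omega> k m a (\<sigma> l) = \<omega> * orbit_point \<omega> k m a l"
        using orbit_point_rotate[OF \<omega>(1) mk] by blast
      \<comment> \<open>Symmetry absorbs the multiplication by \<open>\<omega>\<close>, while
        homogeneity turns it into the factor \<open>\<omega> ^ total_degree (f i)\<close>. That
        factor is not 1, since \<open>k\<close> does not divide the degree.\<close>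
      have "poly_eval (orbit_point \<omega> k m a) (f i) = poly_eval (\<lambda>l. \<omega> * orbit_point \<omega> k m a l) (f i)"
        using poly_eval_permute[OF assms(4)[OF i] \<sigma>(1), of "orbit_point \<omega> k m a"] by (simp add: \<sigma>(2))
      also have "\<dots> = \<omega> ^ total_degree (f i) * poly_eval (orbit_point \<omega> k m a) (f i)"
        by (rule poly_eval_scale[OF deg[OF i]])
      finally have "(\<omega> ^ total_degree (f i) - 1) * poly_eval (orbit_point \<omega> k m a) (f i) = 0"
        by (simp add: algebra_simps)
      moreover have "\<omega> ^ total_degree (f i) \<noteq> 1" using \<omega>(2) False i by (auto simp: T_def)
      ultimately show ?thesis by simp
    qed (rule a(3))
    then have zero: "\<And>l. l \<in> {1..n} \<Longrightarrow> orbit_point \<omega> k m a l = 0"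
      using assms(5) unfolding regular_sequence_def by blast
    \<comment> \<open>As \<open>k \<ge> 1\<close>, position \<open>j + 1\<close> exists and lies in
      block \<open>s = 0\<close>, where the coordinate is the nonzero \<open>a j\<close>
      itself.\<close>
    have "m * 1 \<le> m * k" using k by (intro mult_left_mono) auto
    then have "j + 1 \<le> m * k" using a(1) by linarith
    then have "j + 1 \<in> {1..n}" "j + 1 \<in> {1..m * k}" using mk by auto
    then show False using zero[of "j + 1"] a by (simp add: orbit_point_def)
  qed
  then show "n div k \<le> card {i \<in> {1..n}. k dvd total_degree (f i)}"
    by (simp add: m_def T_def)
qed

end
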